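(* Let $(Y_i,Z_i,W_i)_{i=1}^n$ be an i.i.d. sample of $(Y,Z,W)$ obeying $Y=\varphi(Z)+U$, $\mathbb E[U\mid W]=0$, with $\varphi\in L^2_Z$, and let $h\in L^2_Z$. Suppose that $\mathbb E[U^2\mid W]\le\sigma^2$ for some $\sigma>0$ and that for some $\eta\ge1$ $$\sup_{j\in\mathbb N}\mathbb E[f_j^2(W)\mid Z]\le\eta^2\quad\text{and}\quad\sup_{j,l\in\mathbb N}\mathrm{Var}(e_j(Z)f_l(W))\le\eta^2 .$$ Let $\widehat\ell_h$ be the estimator defined in the context with dimension $m=m(n)$ and threshold $\alpha=\alpha(n)$ satisfying $\alpha\ge2\|[T]_{\underline m}^{-1}\|$ and, as $n\to\infty$, $1/m=o(1)$ and $m^2\alpha^2=o(n)$. If in addition $\sup_{m\in\mathbb N}\|T_m^{-1}F_mTE_m^\perp\|<\infty$, then $$\mathbb E|\widehat\ell_h-\ell_h(\varphi)|^2=o(1)\quad\text{as }n\to\infty.$$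
   Context: $Y$ is real-valued, $Z\in\mathbb R^p$, $W\in\mathbb R^q$. $L^2_Z=\{\phi:\mathbb R^p\to\mathbb R:\ \|\phi\|_Z^2:=\mathbb E[\phi^2(Z)]<\infty\}$ with $\langle\phi,\tilde\phi\rangle_Z=\mathbb E[\phi(Z)\tilde\phi(Z)]$; $L^2_W$ analogously with $W$. $T:L^2_Z\to L^2_W$, $T\phi=\mathbb E[\phi(Z)\mid W]$, is assumed compact and injective. $\ell_h(\varphi):=\langle h,\varphi\rangle_Z$. $\{e_j\}_{j\ge1}$ and $\{f_l\}_{l\ge1}$ are orthonormal bases of $L^2_Z$ and $L^2_W$. $E_m$ and $F_m$ are the orthogonal projections onto $\mathrm{span}(e_1,\dots,e_m)$ and $\mathrm{span}(f_1,\dots,f_m)$, and $E_m^\perp=I-E_m$. $[\phi]_{\underline m}=(\langle\phi,e_j\rangle_Z)_{j\le m}$ for $\phi\in L^2_Z$; $[T]_{\underline m}$ is the $m\times m$ matrix with entries $[T]_{l,j}=\langle Te_j,f_l\rangle_W=\mathbb E[f_l(W)e_j(Z)]$. It is assumed throughout that $[T]_{\underline m}$ is nonsingular for all $m$. $T_m^{-1}:L^2_W\to L^2_Z$ is the operator whose matrix in the bases $\{e_j\},\{f_l\}$ has entries $([T]_{\underline m}^{-1})_{j,l}$ for $1\le j,l\le m$ and zeros otherwise. $\|\cdot\|$ of an operator or matrix is the operator norm. Estimator: with $[e(Z)]_{\underline m}=(e_j(Z))_{j\le m}$, $[f(W)]_{\underline m}=(f_l(W))_{l\le m}$, set $[\widehat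 T]_{\underline m}=\frac1n\sum_{i=1}^n[f(W_i)]_{\underline m}[e(Z_i)]_{\underline m}^t$ and $[\widehat g]_{\underline m}=\frac1n\sum_{i=1}^nY_i[f(W_i)]_{\underline m}$. Then $\widehat\ell_h:=[h]_{\underline m}^t[\widehat T]_{\underline m}^{-1}[\widehat g]_{\underline m}$ if $[\widehat T]_{\underline m}$ is nonsingular and $\|[\widehat T]_{\underline m}^{-1}\|\le\alpha$, and $\widehat\ell_h:=0$ otherwise. *)

theory Defs
  imports
    "HOL-Probability.Probability"
    "Jordan_Normal_Form.Gauss_Jordan_Elimination"
begin

text \<open>
  Elements of \<open>L\<^sup>2\<^sub>X\<close> are represented by Borel functions; two functions are identified when they
  agree almost surely along \<open>X\<close>, that is, when \<open>l2_norm M X\<close> of their difference is zero.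
  All bases, coordinates and samples are indexed from \<open>0\<close>: the functions \<open>e\<^sub>1, \<dots>, e\<^sub>m\<close> are
  \<open>e 0, \<dots>, e (m - 1)\<close>, and a sample of size \<open>n\<close> consists of the observations \<open>i < n\<close>.
\<close>

definition L2 :: "'a measure \<Rightarrow> ('a \<Rightarrow> 'b::euclidean_space) \<Rightarrow> ('b \<Rightarrow> real) set" where
  "L2 M X = {\<phi>. \<phi> \<in> borel_measurable borel \<and> integrable M (\<lambda>\<omega>. (\<phi> (X \<omega>))\<^sup>2)}"

definition l2_inner ::
  "'a measure \<Rightarrow> ('a \<Rightarrow> 'b::euclidean_space) \<Rightarrow> ('b \<Rightarrow> real) \<Rightarrow> ('b \<Rightarrow> real) \<Rightarrow> real" where
  "l2_inner M X \<phi> \<psi> = (\<integral>\<omega>. \<phi> (X \<omega>) * \<psi> (X \<omega>) \<partial>M)"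

definition l2_norm :: "'a measure \<Rightarrow> ('a \<Rightarrow> 'b::euclidean_space) \<Rightarrow> ('b \<Rightarrow> real) \<Rightarrow> real" where
  "l2_norm M X \<phi> = sqrt (l2_inner M X \<phi> \<phi>)"

definition l2_span :: "(nat \<Rightarrow> 'b \<Rightarrow> real) \<Rightarrow> nat \<Rightarrow> ('b \<Rightarrow> real) set" where
  "l2_span e m = {\<lambda>x. \<Sum>j<m. c j * e j x | c. True}"

definition orthonormal_basis ::
  "'a measure \<Rightarrow> ('a \<Rightarrow> 'b::euclidean_space) \<Rightarrow> (nat \<Rightarrow> 'b \<Rightarrow> real) \<Rightarrow> bool" where
  "orthonormal_basis M X e \<longleftrightarrow>
     (\<forall>j. e j \<in> L2 M X) \<and>
     (\<forall>i j. l2_inner M X (e i) (e j) = (if i = j then 1 else 0)) \<and>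
     (\<forall>\<phi>\<in>L2 M X. \<forall>\<epsilon>>0. \<exists>m. \<exists>\<psi>\<in>l2_span e m. l2_norm M X (\<lambda>x. \<phi> x - \<psi> x) < \<epsilon>)"

text \<open>For orthonormal \<open>e\<close> the projection is unique as a function, since the coefficients are.\<close>

definition l2_proj ::
  "'a measure \<Rightarrow> ('a \<Rightarrow> 'b::euclidean_space) \<Rightarrow> (nat \<Rightarrow> 'b \<Rightarrow> real) \<Rightarrow> nat \<Rightarrow>
    ('b \<Rightarrow> real) \<Rightarrow> ('b \<Rightarrow> real)" where
  "l2_proj M X e m \<phi> =
     (THE \<psi>. \<psi> \<in> l2_span e m \<and>
        (\<forall>\<xi>\<in>l2_span e m. l2_inner M X (\<lambda>x. \<phi> x - \<psi> x) \<xi> = 0))"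

definition sigma_gen :: "'a measure \<Rightarrow> ('a \<Rightarrow> 'b::euclidean_space) \<Rightarrow> 'a measure" where
  "sigma_gen M X = vimage_algebra (space M) X borel"

text \<open>
  \<open>T \<phi>\<close> is the regression function \<open>w \<mapsto> E[\<phi>(Z) | W = w]\<close>: an element \<open>\<psi>\<close> of \<open>L\<^sup>2\<^sub>W\<close> with
  \<open>\<psi>(W) = E[\<phi>(Z) | W]\<close> almost surely. Such a \<open>\<psi>\<close> exists for \<open>\<phi> \<in> L\<^sup>2\<^sub>Z\<close> and is unique in \<open>L\<^sup>2\<^sub>W\<close>.
\<close>

definition cond_exp_op ::
  "'a measure \<Rightarrow> ('a \<Rightarrow> 'b::euclidean_space) \<Rightarrow> ('a \<Rightarrow> 'c::euclidean_space) \<Rightarrow>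
    ('b \<Rightarrow> real) \<Rightarrow> ('c \<Rightarrow> real)" where
  "cond_exp_op M Z W \<phi> =
     (SOME \<psi>. \<psi> \<in> L2 M W \<and>
        (AE \<omega> in M. \<psi> (W \<omega>) = real_cond_exp M (sigma_gen M W) (\<lambda>\<omega>. \<phi> (Z \<omega>)) \<omega>))"

definition compact_op ::
  "'a measure \<Rightarrow> ('a \<Rightarrow> 'b::euclidean_space) \<Rightarrow> ('a \<Rightarrow> 'c::euclidean_space) \<Rightarrow>
    (('b \<Rightarrow> real) \<Rightarrow> ('c \<Rightarrow> real)) \<Rightarrow> bool" where
  "compact_op M Z W A \<longleftrightarrow>
     (\<forall>\<Phi> B. (\<forall>k::nat. \<Phi> k \<in> L2 M Z \<and> l2_norm M Z (\<Phi> k) \<le> B) \<longrightarrow>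
        (\<exists>\<psi>\<in>L2 M W. \<exists>r. strict_mono r \<and>
           (\<lambda>k. l2_norm M W (\<lambda>w. A (\<Phi> (r k)) w - \<psi> w)) \<longlonglongrightarrow> 0))"

definition injective_op ::
  "'a measure \<Rightarrow> ('a \<Rightarrow> 'b::euclidean_space) \<Rightarrow> ('a \<Rightarrow> 'c::euclidean_space) \<Rightarrow>
    (('b \<Rightarrow> real) \<Rightarrow> ('c \<Rightarrow> real)) \<Rightarrow> bool" where
  "injective_op M Z W A \<longleftrightarrow>
     (\<forall>\<phi>\<in>L2 M Z. \<forall>\<phi>'\<in>L2 M Z.
        (AE \<omega> in M. A \<phi> (W \<omega>) = A \<phi>' (W \<omega>)) \<longrightarrow> (AE \<omega> in M. \<phi> (Z \<omega>) = \<phi>' (Z \<omega>)))"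

text \<open>Operator norm on \<open>L\<^sup>2\<^sub>Z\<close>, with value \<open>\<infinity>\<close> for unbounded operators.\<close>

definition l2_opnorm ::
  "'a measure \<Rightarrow> ('a \<Rightarrow> 'b::euclidean_space) \<Rightarrow> (('b \<Rightarrow> real) \<Rightarrow> ('b \<Rightarrow> real)) \<Rightarrow> ennreal" where
  "l2_opnorm M Z A =
     (SUP \<phi>\<in>{\<phi>. \<phi> \<in> L2 M Z \<and> l2_norm M Z \<phi> \<le> 1}. ennreal (l2_norm M Z (A \<phi>)))"

definition vec_norm2 :: "real vec \<Rightarrow> real" where
  "vec_norm2 x = sqrt (scalar_prod x x)"

definition mat_opnorm :: "real mat \<Rightarrow> real" where
  "mat_opnorm A = Sup {vec_norm2 (A *\<^sub>v x) | x. x \<in> carrier_vec (dim_col A) \<and> vec_norm2 x \<le> 1}"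

text \<open>Only meaningful for nonsingular matrices.\<close>

definition mat_inv :: "real mat \<Rightarrow> real mat" where
  "mat_inv A = the (mat_inverse A)"

definition coeff_vec ::
  "'a measure \<Rightarrow> ('a \<Rightarrow> 'b::euclidean_space) \<Rightarrow> (nat \<Rightarrow> 'b \<Rightarrow> real) \<Rightarrow> nat \<Rightarrow>
    ('b \<Rightarrow> real) \<Rightarrow> real vec" where
  "coeff_vec M Z e m \<phi> = Matrix.vec m (\<lambda>j. l2_inner M Z \<phi> (e j))"

definition T_mat ::
  "'a measure \<Rightarrow> ('a \<Rightarrow> 'b::euclidean_space) \<Rightarrow> ('a \<Rightarrow> 'c::euclidean_space) \<Rightarrow>
    (nat \<Rightarrow> 'b \<Rightarrow> real) \<Rightarrow> (nat \<Rightarrow> 'c \<Rightarrow> real) \<Rightarrow> nat \<Rightarrow> real mat" where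
  "T_mat M Z W e f m =
     Matrix.mat m m (\<lambda>(l, j). l2_inner M W (cond_exp_op M Z W (e j)) (f l))"

definition T_inv_op ::
  "'a measure \<Rightarrow> ('a \<Rightarrow> 'b::euclidean_space) \<Rightarrow> ('a \<Rightarrow> 'c::euclidean_space) \<Rightarrow>
    (nat \<Rightarrow> 'b \<Rightarrow> real) \<Rightarrow> (nat \<Rightarrow> 'c \<Rightarrow> real) \<Rightarrow> nat \<Rightarrow> ('c \<Rightarrow> real) \<Rightarrow> ('b \<Rightarrow> real)" where
  "T_inv_op M Z W e f m \<psi> =
     (\<lambda>z. \<Sum>j<m. (\<Sum>l<m. mat_inv (T_mat M Z W e f m) $$ (j, l) * l2_inner M W \<psi> (f l)) * e j z)"

text \<open>The operator \<open>T\<^sub>m\<^sup>-\<^sup>1 F\<^sub>m T E\<^sub>m\<^sup>\<bottom>\<close>, where \<open>E\<^sub>m\<^sup>\<bottom> = I - E\<^sub>m\<close>.\<close>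

definition bias_op ::
  "'a measure \<Rightarrow> ('a \<Rightarrow> 'b::euclidean_space) \<Rightarrow> ('a \<Rightarrow> 'c::euclidean_space) \<Rightarrow>
    (nat \<Rightarrow> 'b \<Rightarrow> real) \<Rightarrow> (nat \<Rightarrow> 'c \<Rightarrow> real) \<Rightarrow> nat \<Rightarrow> ('b \<Rightarrow> real) \<Rightarrow> ('b \<Rightarrow> real)" where
  "bias_op M Z W e f m \<phi> =
     T_inv_op M Z W e f m
       (l2_proj M W f m (cond_exp_op M Z W (\<lambda>z. \<phi> z - l2_proj M Z e m \<phi> z)))"

definition T_hat ::
  "(nat \<Rightarrow> 'b \<Rightarrow> real) \<Rightarrow> (nat \<Rightarrow> 'c \<Rightarrow> real) \<Rightarrow> nat \<Rightarrow> nat \<Rightarrow>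
    (nat \<Rightarrow> 'b) \<Rightarrow> (nat \<Rightarrow> 'c) \<Rightarrow> real mat" where
  "T_hat e f m n z w =
     Matrix.mat m m (\<lambda>(l, j). 1 / real n * (\<Sum>i<n. f l (w i) * e j (z i)))"

definition g_hat ::
  "(nat \<Rightarrow> 'c \<Rightarrow> real) \<Rightarrow> nat \<Rightarrow> nat \<Rightarrow> (nat \<Rightarrow> real) \<Rightarrow> (nat \<Rightarrow> 'c) \<Rightarrow> real vec" where
  "g_hat f m n y w = Matrix.vec m (\<lambda>l. 1 / real n * (\<Sum>i<n. y i * f l (w i)))"

text \<open>The estimator with coefficient vector \<open>hv\<close>, dimension \<open>m\<close>, threshold \<open>\<alpha>\<close> and sample size \<open>n\<close>,
  evaluated at the data \<open>y\<close>, \<open>z\<close>, \<open>w\<close>.\<close>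

definition ell_hat ::
  "(nat \<Rightarrow> 'b \<Rightarrow> real) \<Rightarrow> (nat \<Rightarrow> 'c \<Rightarrow> real) \<Rightarrow> real vec \<Rightarrow> nat \<Rightarrow> real \<Rightarrow> nat \<Rightarrow>
    (nat \<Rightarrow> real) \<Rightarrow> (nat \<Rightarrow> 'b) \<Rightarrow> (nat \<Rightarrow> 'c) \<Rightarrow> real" where
  "ell_hat e f hv m \<alpha> n y z w =
     (if invertible_mat (T_hat e f m n z w) \<and> mat_opnorm (mat_inv (T_hat e f m n z w)) \<le> \<alpha>
      then scalar_prod hv (mat_inv (T_hat e f m n z w) *\<^sub>v g_hat f m n y w)
      else 0)"

end

theory Submission
  imports Defs "Jordan_Normal_Form.Determinant"
begin

text \<open>
  Let \<open>T\<^sub>k\<close> be the \<open>k \<times> k\<close> Galerkin matrix with entries \<open>E[e\<^sub>j(Z) f\<^sub>l(W)]\<close>, and let \<open>\<phi>\<^sub>k\<close> be the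
  Galerkin solution: the element of \<open>span(e\<^sub>1, \<dots>, e\<^sub>k)\<close> whose moments \<open>E[\<phi>\<^sub>k(Z) f\<^sub>l(W)]\<close>, \<open>l \<le> k\<close>,
  agree with those of \<open>\<phi>\<close>. Write \<open>c\<close> for its coefficient vector, \<open>h\<close> also for the vector of the
  first \<open>k\<close> coefficients of \<open>h\<close>, and \<open>B\<close> and \<open>g\<close> for the estimates of \<open>T\<^sub>k\<close> and of the moments
  \<open>E[Y f\<^sub>l(W)]\<close>.

  On the event that \<open>B\<close> is invertible with \<open>\<parallel>B\<^sup>-\<^sup>1\<parallel> \<le> \<alpha>\<close>, the estimator equals
  \<open>h \<bullet> c + h \<bullet> B\<^sup>-\<^sup>1 V\<close>, where the defect \<open>V = g - B c\<close> has the sample means of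
  \<open>f\<^sub>l(W) (Y - \<phi>\<^sub>k(Z))\<close> as entries. These variables are centred, since \<open>E[U | W] = 0\<close> and since
  \<open>\<phi> - \<phi>\<^sub>k\<close> has vanishing moments against \<open>f\<^sub>1, \<dots>, f\<^sub>k\<close>; their second moments are at most
  \<open>2(\<sigma>\<^sup>2 + \<eta>\<^sup>2\<parallel>\<phi> - \<phi>\<^sub>k\<parallel>\<^sup>2)\<close>. Hence \<open>E\<parallel>V\<parallel>\<^sup>2\<close> is of order \<open>k / n\<close>, and the stochastic part of the error
  is of order \<open>\<alpha>\<^sup>2 k / n\<close> in mean square. The deterministic part \<open>h \<bullet> c - \<langle>h, \<phi>\<rangle> = \<langle>h, \<phi>\<^sub>k - \<phi>\<rangle>\<close> tends
  to zero: \<open>\<phi>\<^sub>k - E\<^sub>k \<phi>\<close> is the value at \<open>\<phi>\<close> of the bias operator, which factors through \<open>E\<^sub>k\<^sup>\<bottom>\<close>, so the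
  stability assumption bounds \<open>\<parallel>\<phi> - \<phi>\<^sub>k\<parallel>\<close> by a constant times \<open>\<parallel>E\<^sub>k\<^sup>\<bottom> \<phi>\<parallel>\<close> (lemma
  \<open>galerkin_error_le\<close>).

  On the complementary event the estimator is zero and the error is the fixed number \<open>\<langle>h, \<phi>\<rangle>\<close>. Since
  \<open>\<alpha> \<ge> 2\<parallel>T\<^sub>k\<^sup>-\<^sup>1\<parallel>\<close>, a perturbation argument (lemma \<open>mat_inv_perturbation\<close>) shows that this event forces
  \<open>\<alpha>\<^sup>2 \<parallel>B - T\<^sub>k\<parallel>\<^sup>2 > 1\<close> in Frobenius norm. So the squared error there is at most
  \<open>\<langle>h, \<phi>\<rangle>\<^sup>2 \<alpha>\<^sup>2 \<parallel>B - T\<^sub>k\<parallel>\<^sup>2\<close>, whose mean is of order \<open>\<alpha>\<^sup>2 k\<^sup>2 / n\<close> by the variance assumption.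

  Both cases combine into one pointwise bound (lemma \<open>ell_hat_error_le\<close>). Integrating it gives
  the finite-sample inequality \<open>risk_bound\<close>, from which the theorem follows by the rate
  assumptions.
\<close>

\<comment> \<open>Both vector libraries use the dollar sign; here it selects components of matrix-library vectors.\<close>
unbundle no vec_syntax

section \<open>Euclidean and operator norms of matrices\<close>

lemma vec_norm2_eq_L2_set: "vec_norm2 x = L2_set (\<lambda>i. x $ i) {..<dim_vec x}"
  by (simp add: vec_norm2_def L2_set_def scalar_prod_def power2_eq_square atLeast0LessThan)

lemma vec_norm2_nonneg [simp]: "0 \<le> vec_norm2 x"
  by (simp add: vec_norm2_eq_L2_set)

lemma vec_norm2_power2: "(vec_norm2 x)\<^sup>2 = (\<Sum>i<dim_vec x. (x $ i)\<^sup>2)"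
  by (simp add: vec_norm2_eq_L2_set L2_set_def sum_nonneg)

lemma vec_norm2_eq_0_iff:
  assumes "x \<in> carrier_vec k"
  shows "vec_norm2 x = 0 \<longleftrightarrow> x = 0\<^sub>v k"
  using assms by (auto simp: vec_norm2_eq_L2_set L2_set_eq_0_iff)

lemma vec_norm2_smult: "vec_norm2 (c \<cdot>\<^sub>v x) = \<bar>c\<bar> * vec_norm2 x"
  by (simp add: vec_norm2_def real_sqrt_mult mult.assoc[symmetric])

lemma vec_norm2_minus_le:
  assumes "x \<in> carrier_vec k" "y \<in> carrier_vec k"
  shows "vec_norm2 x \<le> vec_norm2 y + vec_norm2 (y - x)"
proof -
  have "vec_norm2 x = L2_set (\<lambda>i. y $ i + - (y - x) $ i) {..<k}"
    using assms unfolding vec_norm2_eq_L2_set by (intro L2_set_cong) auto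
  also have "\<dots> \<le> L2_set (\<lambda>i. y $ i) {..<k} + L2_set (\<lambda>i. - (y - x) $ i) {..<k}"
    by (rule L2_set_triangle_ineq)
  also have "\<dots> = vec_norm2 y + vec_norm2 (y - x)"
    using assms by (simp add: vec_norm2_eq_L2_set L2_set_def power2_commute)
  finally show ?thesis .
qed

lemma abs_scalar_prod_le:
  assumes "x \<in> carrier_vec k" "y \<in> carrier_vec k"
  shows "\<bar>x \<bullet> y\<bar> \<le> vec_norm2 x * vec_norm2 y"
proof -
  have "\<bar>x \<bullet> y\<bar> \<le> (\<Sum>i<k. \<bar>x $ i\<bar> * \<bar>y $ i\<bar>)"
    using assms by (simp add: scalar_prod_def atLeast0LessThan abs_mult[symmetric])
  also have "\<dots> \<le> vec_norm2 x * vec_norm2 y"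
    using assms by (simp add: vec_norm2_eq_L2_set L2_set_mult_ineq)
  finally show ?thesis .
qed

definition frobenius_sq :: "real mat \<Rightarrow> real" where
  "frobenius_sq A = (\<Sum>i<dim_row A. \<Sum>j<dim_col A. (A $$ (i, j))\<^sup>2)"

lemma frobenius_sq_nonneg [simp]: "0 \<le> frobenius_sq A"
  by (simp add: frobenius_sq_def sum_nonneg)

lemma vec_norm2_mult_le_frobenius:
  assumes "A \<in> carrier_mat r c" "x \<in> carrier_vec c"
  shows "vec_norm2 (A *\<^sub>v x) \<le> sqrt (frobenius_sq A) * vec_norm2 x"
proof (rule power2_le_imp_le)
  have "(vec_norm2 (A *\<^sub>v x))\<^sup>2 = (\<Sum>i<r. (row A i \<bullet> x)\<^sup>2)"
    using assms by (simp add: vec_norm2_power2)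
  also have "\<dots> \<le> (\<Sum>i<r. (vec_norm2 (row A i))\<^sup>2 * (vec_norm2 x)\<^sup>2)"
  proof (intro sum_mono)
    fix i assume "i \<in> {..<r}"
    then have "\<bar>row A i \<bullet> x\<bar> \<le> vec_norm2 (row A i) * vec_norm2 x"
      using assms by (intro abs_scalar_prod_le[of _ c]) auto
    then show "(row A i \<bullet> x)\<^sup>2 \<le> (vec_norm2 (row A i))\<^sup>2 * (vec_norm2 x)\<^sup>2"
      by (metis abs_ge_zero power2_abs power_mono power_mult_distrib)
  qed
  also have "\<dots> = frobenius_sq A * (vec_norm2 x)\<^sup>2"
    using assms by (simp add: vec_norm2_power2 frobenius_sq_def sum_distrib_right)
  finally show "(vec_norm2 (A *\<^sub>v x))\<^sup>2 \<le> (sqrt (frobenius_sq A) * vec_norm2 x)\<^sup>2"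
    by (simp add: power_mult_distrib)
qed simp

lemma bdd_above_mat_opnorm:
  "bdd_above {vec_norm2 (A *\<^sub>v x) | x. x \<in> carrier_vec (dim_col A) \<and> vec_norm2 x \<le> 1}"
proof (rule bdd_aboveI)
  fix s assume "s \<in> {vec_norm2 (A *\<^sub>v x) | x. x \<in> carrier_vec (dim_col A) \<and> vec_norm2 x \<le> 1}"
  then obtain y where y: "s = vec_norm2 (A *\<^sub>v y)" "y \<in> carrier_vec (dim_col A)" "vec_norm2 y \<le> 1"
    by auto
  have "s \<le> sqrt (frobenius_sq A) * vec_norm2 y"
    using vec_norm2_mult_le_frobenius[of A "dim_row A" "dim_col A" y] y by simp
  also have "\<dots> \<le> sqrt (frobenius_sq A) * 1"
    using y(3) by (intro mult_left_mono) auto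
  finally show "s \<le> sqrt (frobenius_sq A)" by simp
qed

lemma mat_opnorm_nonneg: "0 \<le> mat_opnorm A"
  unfolding mat_opnorm_def
proof (rule cSup_upper[OF _ bdd_above_mat_opnorm])
  show "0 \<in> {vec_norm2 (A *\<^sub>v x) | x. x \<in> carrier_vec (dim_col A) \<and> vec_norm2 x \<le> 1}"
    by (intro CollectI exI[of _ "0\<^sub>v (dim_col A)"])
      (auto simp: vec_norm2_eq_L2_set L2_set_def scalar_prod_def)
qed

lemma vec_norm2_mult_le_opnorm:
  assumes A: "A \<in> carrier_mat r c" and x: "x \<in> carrier_vec c"
  shows "vec_norm2 (A *\<^sub>v x) \<le> mat_opnorm A * vec_norm2 x"
proof (cases "vec_norm2 x = 0")
  case True
  then show ?thesis
    using vec_norm2_mult_le_frobenius[OF A x] by simp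
next
  case False
  then have pos: "vec_norm2 x > 0"
    by (simp add: less_le)
  let ?u = "(1 / vec_norm2 x) \<cdot>\<^sub>v x"
  have "vec_norm2 (A *\<^sub>v ?u) \<le> mat_opnorm A"
    unfolding mat_opnorm_def
  proof (rule cSup_upper[OF _ bdd_above_mat_opnorm], intro CollectI exI[of _ ?u] conjI refl)
    show "?u \<in> carrier_vec (dim_col A)" "vec_norm2 ?u \<le> 1"
      using A x pos by (auto simp: vec_norm2_smult)
  qed
  moreover have "A *\<^sub>v ?u = (1 / vec_norm2 x) \<cdot>\<^sub>v (A *\<^sub>v x)"
    using A x by (rule mult_mat_vec)
  ultimately show ?thesis
    using pos by (simp add: vec_norm2_smult field_simps)
qed

lemma mat_opnorm_le:
  assumes A: "A \<in> carrier_mat r c" and "\<And>x. x \<in> carrier_vec c \<Longrightarrow> vec_norm2 (A *\<^sub>v x) \<le> b * vec_norm2 x"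
    and "0 \<le> b"
  shows "mat_opnorm A \<le> b"
  unfolding mat_opnorm_def
proof (rule cSup_least)
  show "{vec_norm2 (A *\<^sub>v x) | x. x \<in> carrier_vec (dim_col A) \<and> vec_norm2 x \<le> 1} \<noteq> {}"
    by (auto intro!: exI[of _ "0\<^sub>v (dim_col A)"] simp: vec_norm2_def)
next
  fix s assume "s \<in> {vec_norm2 (A *\<^sub>v x) | x. x \<in> carrier_vec (dim_col A) \<and> vec_norm2 x \<le> 1}"
  then obtain y where y: "s = vec_norm2 (A *\<^sub>v y)" "y \<in> carrier_vec c" "vec_norm2 y \<le> 1"
    using A by auto
  then have "s \<le> b * vec_norm2 y"
    using assms(2) by simp
  also have "\<dots> \<le> b"
    using y(3) \<open>0 \<le> b\<close> by (simp add: mult_left_le)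
  finally show "s \<le> b" .
qed

lemma mat_inv_inverse:
  assumes A: "A \<in> carrier_mat k k" and inv: "invertible_mat A"
  shows "A * mat_inv A = 1\<^sub>m k" "mat_inv A * A = 1\<^sub>m k" "mat_inv A \<in> carrier_mat k k"
proof -
  obtain B where B: "A * B = 1\<^sub>m k" "B * A = 1\<^sub>m (dim_row B)"
    using inv A by (auto simp: invertible_mat_def inverts_mat_def)
  have B': "B \<in> carrier_mat k k"
    using A B by (metis carrier_matD(2) carrier_matI index_mult_mat(2,3) index_one_mat(2,3))
  then have "A \<in> Units (ring_mat TYPE(real) k ())"
    using A B by (auto simp: Units_def ring_mat_def)
  then obtain C where "mat_inverse A = Some C"
    using mat_inverse(1)[OF A, of "()"] by (cases "mat_inverse A") auto
  then show "A * mat_inv A = 1\<^sub>m k" "mat_inv A * A = 1\<^sub>m k" "mat_inv A \<in> carrier_mat k k"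
    using mat_inverse(2)[OF A] by (auto simp: mat_inv_def)
qed

text \<open>
  The bound \<open>2\<parallel>A\<^sup>-\<^sup>1\<parallel> \<le> a\<close> gives \<open>\<parallel>x\<parallel> \<le> (a/2)\<parallel>A x\<parallel> \<le> (a/2)\<parallel>B x\<parallel> + (a/2)\<parallel>B - A\<parallel> \<parallel>x\<parallel>\<close>. The operator
  norm of \<open>B - A\<close> is at most its Frobenius norm, so \<open>a \<parallel>B - A\<parallel> \<le> 1\<close>, and the last term is at most
  \<open>\<parallel>x\<parallel>/2\<close>. Absorbing it leaves \<open>\<parallel>x\<parallel> \<le> a \<parallel>B x\<parallel>\<close>: the matrix \<open>B\<close> is injective, and its inverse has norm at most \<open>a\<close>.
\<close>

lemma mat_inv_perturbation:
  assumes A: "A \<in> carrier_mat k k" and B: "B \<in> carrier_mat k k"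
    and inv: "invertible_mat A"
    and a: "2 * mat_opnorm (mat_inv A) \<le> a"
    and small: "a\<^sup>2 * frobenius_sq (B - A) \<le> 1" and "0 \<le> a"
  shows "invertible_mat B" "mat_opnorm (mat_inv B) \<le> a"
proof -
  note Ainv = mat_inv_inverse[OF A inv]
  have "a * sqrt (frobenius_sq (B - A)) \<le> 1"
    using small \<open>0 \<le> a\<close> real_sqrt_le_mono[OF small] by (simp add: real_sqrt_mult)
  have lower: "vec_norm2 x \<le> a * vec_norm2 (B *\<^sub>v x)" if x: "x \<in> carrier_vec k" for x
  proof -
    have Ax: "A *\<^sub>v x \<in> carrier_vec k" and Bx: "B *\<^sub>v x \<in> carrier_vec k"
      using A B x by auto
    have "x = mat_inv A *\<^sub>v (A *\<^sub>v x)"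
      using x Ainv A by (simp flip: assoc_mult_mat_vec)
    then have "vec_norm2 x \<le> mat_opnorm (mat_inv A) * vec_norm2 (A *\<^sub>v x)"
      using vec_norm2_mult_le_opnorm[OF Ainv(3) Ax] by simp
    also have "\<dots> \<le> a / 2 * vec_norm2 (A *\<^sub>v x)"
      using a by (intro mult_right_mono) auto
    also have "\<dots> \<le> a / 2 * (vec_norm2 (B *\<^sub>v x) + vec_norm2 (B *\<^sub>v x - A *\<^sub>v x))"
      using vec_norm2_minus_le[OF Ax Bx] \<open>0 \<le> a\<close> by (intro mult_left_mono) auto
    also have "B *\<^sub>v x - A *\<^sub>v x = (B - A) *\<^sub>v x"
      using A B x by (simp add: minus_mult_distrib_mat_vec)
    also have "a / 2 * (vec_norm2 (B *\<^sub>v x) + vec_norm2 ((B - A) *\<^sub>v x)) \<le>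
        a / 2 * (vec_norm2 (B *\<^sub>v x) + sqrt (frobenius_sq (B - A)) * vec_norm2 x)"
      using vec_norm2_mult_le_frobenius[OF minus_carrier_mat[OF A] x] \<open>0 \<le> a\<close>
      by (intro mult_left_mono add_left_mono) auto
    also have "\<dots> = a / 2 * vec_norm2 (B *\<^sub>v x)
        + (a * sqrt (frobenius_sq (B - A))) * vec_norm2 x / 2"
      by (simp add: algebra_simps)
    also have "\<dots> \<le> a / 2 * vec_norm2 (B *\<^sub>v x) + vec_norm2 x / 2"
      using mult_right_mono[OF \<open>a * sqrt (frobenius_sq (B - A)) \<le> 1\<close>, of "vec_norm2 x"]
      by simp
    finally show ?thesis by simp
  qed
  have "Determinant.det B \<noteq> 0"
  proof
    assume "Determinant.det B = 0"
    then obtain v where v: "v \<in> carrier_vec k" "v \<noteq> 0\<^sub>v k" "B *\<^sub>v v = 0\<^sub>v k"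
      using det_0_iff_vec_prod_zero[OF B] by auto
    then have "vec_norm2 v \<le> 0"
      using lower[OF v(1)] vec_norm2_eq_0_iff[of "0\<^sub>v k" k] by simp
    then show False
      using v vec_norm2_eq_0_iff[OF v(1)] vec_norm2_nonneg[of v] by linarith
  qed
  then show invB: "invertible_mat B"
    using det_non_zero_imp_unit[OF B] B
    by (auto simp: Units_def ring_mat_def invertible_mat_def inverts_mat_def square_mat.simps)
  note Binv = mat_inv_inverse[OF B invB]
  show "mat_opnorm (mat_inv B) \<le> a"
  proof (rule mat_opnorm_le[OF Binv(3) _ \<open>0 \<le> a\<close>])
    fix y :: "real vec" assume y: "y \<in> carrier_vec k"
    have "B *\<^sub>v (mat_inv B *\<^sub>v y) = y"
      using y B Binv by (simp flip: assoc_mult_mat_vec)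
    then show "vec_norm2 (mat_inv B *\<^sub>v y) \<le> a * vec_norm2 y"
      using lower[of "mat_inv B *\<^sub>v y"] Binv(3) y by simp
  qed
qed

section \<open>Square-integrable functions of a random variable\<close>

lemma L2_measurable:
  assumes "\<phi> \<in> L2 M X"
  shows "\<phi> \<in> borel_measurable borel"
  using assms by (simp add: L2_def)

lemma integrable_mult_of_squares:
  fixes u v :: "'a \<Rightarrow> real"
  assumes [measurable]: "u \<in> borel_measurable M" "v \<in> borel_measurable M"
    and "integrable M (\<lambda>\<omega>. (u \<omega>)\<^sup>2)" "integrable M (\<lambda>\<omega>. (v \<omega>)\<^sup>2)"
  shows "integrable M (\<lambda>\<omega>. u \<omega> * v \<omega>)"
proof (rule Bochner_Integration.integrable_bound)
  show "integrable M (\<lambda>\<omega>. (u \<omega>)\<^sup>2 + (v \<omega>)\<^sup>2)"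
    using assms by simp
  show "AE \<omega> in M. norm (u \<omega> * v \<omega>) \<le> norm ((u \<omega>)\<^sup>2 + (v \<omega>)\<^sup>2)"
  proof (rule AE_I2)
    fix \<omega>
    have "2 * (\<bar>u \<omega>\<bar> * \<bar>v \<omega>\<bar>) \<le> (u \<omega>)\<^sup>2 + (v \<omega>)\<^sup>2"
      using zero_le_power2[of "\<bar>u \<omega>\<bar> - \<bar>v \<omega>\<bar>"] by (simp add: power2_diff)
    moreover have "0 \<le> \<bar>u \<omega>\<bar> * \<bar>v \<omega>\<bar>"
      by simp
    ultimately show "norm (u \<omega> * v \<omega>) \<le> norm ((u \<omega>)\<^sup>2 + (v \<omega>)\<^sup>2)"
      unfolding real_norm_def abs_mult by linarith
  qed
qed simp

lemma integrable_L2_mult: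
  assumes [measurable]: "X \<in> borel_measurable M" "X' \<in> borel_measurable M"
    and "\<phi> \<in> L2 M X" "\<psi> \<in> L2 M X'"
  shows "integrable M (\<lambda>\<omega>. \<phi> (X \<omega>) * \<psi> (X' \<omega>))"
proof -
  have [measurable]: "\<phi> \<in> borel_measurable borel" "\<psi> \<in> borel_measurable borel"
    using assms by (auto simp: L2_def)
  show ?thesis
    using assms by (intro integrable_mult_of_squares) (auto simp: L2_def)
qed

lemma L2_scale:
  assumes "\<phi> \<in> L2 M X"
  shows "(\<lambda>x. c * \<phi> x) \<in> L2 M X"
  using assms by (auto simp: L2_def power_mult_distrib)

lemma L2_add:
  assumes X: "X \<in> borel_measurable M" and \<phi>: "\<phi> \<in> L2 M X" and \<psi>: "\<psi> \<in> L2 M X"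
  shows "(\<lambda>x. \<phi> x + \<psi> x) \<in> L2 M X"
proof -
  have "integrable M (\<lambda>\<omega>. (\<phi> (X \<omega>))\<^sup>2 + (\<psi> (X \<omega>))\<^sup>2 + 2 * (\<phi> (X \<omega>) * \<psi> (X \<omega>)))"
    using \<phi> \<psi> integrable_L2_mult[OF X X \<phi> \<psi>] by (auto simp: L2_def)
  then show ?thesis
    using \<phi> \<psi> by (auto simp: L2_def power2_sum mult.assoc)
qed

lemma L2_diff:
  assumes X: "X \<in> borel_measurable M" and \<phi>: "\<phi> \<in> L2 M X" and \<psi>: "\<psi> \<in> L2 M X"
  shows "(\<lambda>x. \<phi> x - \<psi> x) \<in> L2 M X"
  using L2_add[OF X \<phi> L2_scale[OF \<psi>, of "-1"]] by simp

lemma l2_inner_commute: "l2_inner M X \<phi> \<psi> = l2_inner M X \<psi> \<phi>"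
  by (simp add: l2_inner_def mult.commute)

lemma l2_inner_scale_left: "l2_inner M X (\<lambda>x. c * \<phi> x) \<psi> = c * l2_inner M X \<phi> \<psi>"
  unfolding l2_inner_def mult.assoc by (rule integral_mult_right_zero)

lemma l2_inner_scale_right: "l2_inner M X \<phi> (\<lambda>x. c * \<psi> x) = c * l2_inner M X \<phi> \<psi>"
  by (subst (1 2) l2_inner_commute) (rule l2_inner_scale_left)

lemma l2_inner_add_left:
  assumes X: "X \<in> borel_measurable M" and "\<phi> \<in> L2 M X" "\<phi>' \<in> L2 M X" "\<psi> \<in> L2 M X"
  shows "l2_inner M X (\<lambda>x. \<phi> x + \<phi>' x) \<psi> = l2_inner M X \<phi> \<psi> + l2_inner M X \<phi>' \<psi>"
  using assms integrable_L2_mult[OF X X]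
  by (simp add: l2_inner_def distrib_right)

lemma l2_inner_diff_left:
  assumes X: "X \<in> borel_measurable M" and "\<phi> \<in> L2 M X" "\<phi>' \<in> L2 M X" "\<psi> \<in> L2 M X"
  shows "l2_inner M X (\<lambda>x. \<phi> x - \<phi>' x) \<psi> = l2_inner M X \<phi> \<psi> - l2_inner M X \<phi>' \<psi>"
  using assms integrable_L2_mult[OF X X]
  by (simp add: l2_inner_def left_diff_distrib)

lemma l2_inner_self_nonneg: "0 \<le> l2_inner M X \<phi> \<phi>"
  by (simp add: l2_inner_def)

lemma l2_norm_nonneg: "0 \<le> l2_norm M X \<phi>"
  by (simp add: l2_norm_def l2_inner_self_nonneg)

lemma l2_norm_power2: "(l2_norm M X \<phi>)\<^sup>2 = l2_inner M X \<phi> \<phi>"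
  by (simp add: l2_norm_def l2_inner_self_nonneg)

lemma l2_norm_scale: "l2_norm M X (\<lambda>x. c * \<phi> x) = \<bar>c\<bar> * l2_norm M X \<phi>"
proof -
  have "l2_inner M X (\<lambda>x. c * \<phi> x) (\<lambda>x. c * \<phi> x) = c\<^sup>2 * l2_inner M X \<phi> \<phi>"
    unfolding l2_inner_scale_left l2_inner_scale_right power2_eq_square by (rule mult.assoc[symmetric])
  then show ?thesis
    by (simp add: l2_norm_def real_sqrt_mult)
qed

lemma l2_norm_add_power2:
  assumes X: "X \<in> borel_measurable M" and \<phi>: "\<phi> \<in> L2 M X" and \<psi>: "\<psi> \<in> L2 M X"
  shows "(l2_norm M X (\<lambda>x. \<phi> x + \<psi> x))\<^sup>2
    = (l2_norm M X \<phi>)\<^sup>2 + 2 * l2_inner M X \<phi> \<psi> + (l2_norm M X \<psi>)\<^sup>2"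
proof -
  note sum = L2_add[OF X \<phi> \<psi>]
  have "l2_inner M X (\<lambda>x. \<phi> x + \<psi> x) (\<lambda>x. \<phi> x + \<psi> x)
      = l2_inner M X (\<lambda>x. \<phi> x + \<psi> x) \<phi> + l2_inner M X (\<lambda>x. \<phi> x + \<psi> x) \<psi>"
    using l2_inner_add_left[OF X \<phi> \<psi> sum] by (simp add: l2_inner_commute)
  then show ?thesis
    using l2_inner_add_left[OF X \<phi> \<psi> \<phi>] l2_inner_add_left[OF X \<phi> \<psi> \<psi>]
    by (simp add: l2_norm_power2 l2_inner_commute[of M X \<psi> \<phi>])
qed

text \<open>
  The form \<open>\<parallel>s \<phi> + t \<psi>\<parallel>\<^sup>2\<close> in \<open>(s, t)\<close> is nonnegative; evaluating it at \<open>(\<parallel>\<psi>\<parallel>\<^sup>2, -\<langle>\<phi>, \<psi>\<rangle>)\<close> gives the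
  inequality when \<open>\<parallel>\<psi>\<parallel> \<noteq> 0\<close>. When \<open>\<parallel>\<psi>\<parallel> = 0\<close>, the form is affine in \<open>t\<close> for \<open>s = 1\<close> and would become negative
  for some \<open>t\<close> unless \<open>\<langle>\<phi>, \<psi>\<rangle> = 0\<close>.
\<close>

lemma l2_cauchy_schwarz:
  assumes X: "X \<in> borel_measurable M" and \<phi>: "\<phi> \<in> L2 M X" and \<psi>: "\<psi> \<in> L2 M X"
  shows "\<bar>l2_inner M X \<phi> \<psi>\<bar> \<le> l2_norm M X \<phi> * l2_norm M X \<psi>"
proof -
  define A B C where "A = (l2_norm M X \<phi>)\<^sup>2" "B = l2_inner M X \<phi> \<psi>" "C = (l2_norm M X \<psi>)\<^sup>2"
  have form: "0 \<le> s\<^sup>2 * A + 2 * (s * t * B) + t\<^sup>2 * C" for s t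
    using l2_norm_add_power2[OF X L2_scale[OF \<phi>, of s] L2_scale[OF \<psi>, of t]]
      zero_le_power2[of "l2_norm M X (\<lambda>x. s * \<phi> x + t * \<psi> x)"]
    unfolding A_B_C_def
    by (simp add: l2_norm_scale power_mult_distrib l2_inner_scale_left
        l2_inner_scale_right mult.assoc)
  have "B\<^sup>2 \<le> A * C"
  proof (cases "C = 0")
    case True
    show ?thesis
    proof (rule ccontr)
      assume "\<not> ?thesis"
      then have "B \<noteq> 0" using True by auto
      then have "0 \<le> A + 2 * (- (A + 1))"
        using form[of 1 "- (A + 1) / B"] True by simp
      moreover have "0 \<le> A"
        by (simp add: A_B_C_def(1))
      ultimately show False by simp
    qed
  next
    case False
    then have "C > 0" by (simp add: A_B_C_def(3))
    have "0 \<le> C * (A * C - B\<^sup>2)"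
      using form[of C "- B"] by (simp add: power2_eq_square algebra_simps)
    then show ?thesis using \<open>C > 0\<close> by (simp add: zero_le_mult_iff)
  qed
  then have "\<bar>B\<bar>\<^sup>2 \<le> (l2_norm M X \<phi> * l2_norm M X \<psi>)\<^sup>2"
    by (simp add: A_B_C_def power_mult_distrib)
  then show ?thesis
    unfolding A_B_C_def by (rule power2_le_imp_le) (simp add: l2_norm_nonneg)
qed

lemma l2_norm_triangle:
  assumes X: "X \<in> borel_measurable M" and \<phi>: "\<phi> \<in> L2 M X" and \<psi>: "\<psi> \<in> L2 M X"
  shows "l2_norm M X (\<lambda>x. \<phi> x + \<psi> x) \<le> l2_norm M X \<phi> + l2_norm M X \<psi>"
proof (rule power2_le_imp_le)
  show "(l2_norm M X (\<lambda>x. \<phi> x + \<psi> x))\<^sup>2 \<le> (l2_norm M X \<phi> + l2_norm M X \<psi>)\<^sup>2"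
    using l2_cauchy_schwarz[OF X \<phi> \<psi>]
    by (simp add: l2_norm_add_power2[OF X \<phi> \<psi>] power2_sum)
qed (simp add: l2_norm_nonneg)

section \<open>Fourier sums\<close>

definition basis_sum :: "(nat \<Rightarrow> 'b \<Rightarrow> real) \<Rightarrow> nat \<Rightarrow> (nat \<Rightarrow> real) \<Rightarrow> 'b \<Rightarrow> real" where
  "basis_sum e k c = (\<lambda>x. \<Sum>j<k. c j * e j x)"

lemma l2_span_eq_range: "l2_span e k = range (basis_sum e k)"
  by (auto simp: l2_span_def basis_sum_def)

lemma basis_sum_L2:
  assumes X: "X \<in> borel_measurable M" and e: "\<And>j. e j \<in> L2 M X"
  shows "basis_sum e k c \<in> L2 M X"
proof (induction k)
  case 0
  show ?case by (simp add: basis_sum_def L2_def)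
next
  case (Suc k)
  then show ?case
    using L2_add[OF X Suc.IH L2_scale[OF e]] by (simp add: basis_sum_def)
qed

lemma l2_inner_basis_sum_left:
  assumes X: "X \<in> borel_measurable M" and e: "\<And>j. e j \<in> L2 M X" and \<psi>: "\<psi> \<in> L2 M X"
  shows "l2_inner M X (basis_sum e k c) \<psi> = (\<Sum>j<k. c j * l2_inner M X (e j) \<psi>)"
  using integrable_L2_mult[OF X X e \<psi>]
  by (simp add: l2_inner_def basis_sum_def sum_distrib_right mult.assoc)

lemma orthonormal_basis_L2: "orthonormal_basis M X e \<Longrightarrow> e j \<in> L2 M X"
  by (simp add: orthonormal_basis_def)

lemma l2_inner_basis_sum_basis:
  assumes X: "X \<in> borel_measurable M" and e: "orthonormal_basis M X e" and "i < k"
  shows "l2_inner M X (basis_sum e k c) (e i) = c i"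
proof -
  have "l2_inner M X (basis_sum e k c) (e i) = (\<Sum>j<k. c j * (if j = i then 1 else 0))"
    using e by (simp add: l2_inner_basis_sum_left[OF X] orthonormal_basis_def)
  then show ?thesis using \<open>i < k\<close> by (simp add: if_distrib cong: if_cong)
qed

lemma l2_norm_basis_sum_power2:
  assumes X: "X \<in> borel_measurable M" and e: "orthonormal_basis M X e"
  shows "(l2_norm M X (basis_sum e k c))\<^sup>2 = (\<Sum>j<k. (c j)\<^sup>2)"
proof -
  note eL2 = orthonormal_basis_L2[OF e]
  have "(l2_norm M X (basis_sum e k c))\<^sup>2 = (\<Sum>j<k. c j * l2_inner M X (basis_sum e k c) (e j))"
    using l2_inner_basis_sum_left[OF X eL2 basis_sum_L2[OF X eL2], where k = k and c = c]
    by (simp add: l2_norm_power2 l2_inner_commute)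
  then show ?thesis
    by (simp add: l2_inner_basis_sum_basis[OF X e] power2_eq_square)
qed

text \<open>
  The orthogonal projection given by its Fourier coefficients, an explicit form of \<open>l2_proj\<close>.
\<close>

definition fourier_sum ::
  "'a measure \<Rightarrow> ('a \<Rightarrow> 'b::euclidean_space) \<Rightarrow> (nat \<Rightarrow> 'b \<Rightarrow> real) \<Rightarrow> nat \<Rightarrow>
    ('b \<Rightarrow> real) \<Rightarrow> ('b \<Rightarrow> real)" where
  "fourier_sum M X e k \<phi> = basis_sum e k (\<lambda>j. l2_inner M X \<phi> (e j))"

lemma fourier_sum_residual_orthogonal:
  assumes X: "X \<in> borel_measurable M" and e: "orthonormal_basis M X e" and \<phi>: "\<phi> \<in> L2 M X"
  shows "l2_inner M X (\<lambda>x. \<phi> x - fourier_sum M X e k \<phi> x) (basis_sum e k c) = 0"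
proof -
  note eL2 = orthonormal_basis_L2[OF e]
  have P: "fourier_sum M X e k \<phi> \<in> L2 M X"
    unfolding fourier_sum_def by (rule basis_sum_L2[OF X eL2])
  have "l2_inner M X (e j) (\<lambda>x. \<phi> x - fourier_sum M X e k \<phi> x) = 0" if "j < k" for j
    using l2_inner_diff_left[OF X \<phi> P eL2] l2_inner_basis_sum_basis[OF X e that]
    by (simp add: l2_inner_commute[of M X "e j"] fourier_sum_def)
  then show ?thesis
    using l2_inner_basis_sum_left[OF X eL2 L2_diff[OF X \<phi> P], where k = k and c = c]
    by (simp add: l2_inner_commute[of M X _ "basis_sum e k c"])
qed

lemma l2_proj_eq_fourier_sum:
  assumes X: "X \<in> borel_measurable M" and e: "orthonormal_basis M X e" and \<phi>: "\<phi> \<in> L2 M X"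
  shows "l2_proj M X e k \<phi> = fourier_sum M X e k \<phi>"
  unfolding l2_proj_def
proof (rule the_equality)
  show "fourier_sum M X e k \<phi> \<in> l2_span e k \<and>
      (\<forall>\<xi>\<in>l2_span e k. l2_inner M X (\<lambda>x. \<phi> x - fourier_sum M X e k \<phi> x) \<xi> = 0)"
    using fourier_sum_residual_orthogonal[OF X e \<phi>]
    by (auto simp: l2_span_eq_range fourier_sum_def)
next
  fix \<psi> assume *: "\<psi> \<in> l2_span e k \<and> (\<forall>\<xi>\<in>l2_span e k. l2_inner M X (\<lambda>x. \<phi> x - \<psi> x) \<xi> = 0)"
  then obtain c where c: "\<psi> = basis_sum e k c"
    by (auto simp: l2_span_eq_range)
  note eL2 = orthonormal_basis_L2[OF e]
  have "c j = l2_inner M X \<phi> (e j)" if "j < k" for j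
  proof -
    have "e j = basis_sum e k (\<lambda>i. if i = j then 1 else 0)"
      using that by (auto simp: basis_sum_def if_distrib[of "\<lambda>a. a * _"] cong: if_cong)
    then have "l2_inner M X (\<lambda>x. \<phi> x - \<psi> x) (e j) = 0"
      using * by (auto simp: l2_span_eq_range)
    moreover have psi: "basis_sum e k c \<in> L2 M X"
      by (rule basis_sum_L2[OF X eL2])
    ultimately show ?thesis
      using l2_inner_diff_left[OF X \<phi> psi eL2, of j]
        l2_inner_basis_sum_basis[OF X e that, where c = c] by (simp add: c)
  qed
  then show "\<psi> = fourier_sum M X e k \<phi>"
    by (auto simp: c fourier_sum_def basis_sum_def)
qed

text \<open>
  Any element of the span splits off the Fourier sum, and the difference of the two lies in the
  span, hence is orthogonal to the residual of \<open>\<phi>\<close>. This one identity contains both Bessel's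
  inequality (take \<open>c = 0\<close>) and the best approximation property of Fourier sums.
\<close>

lemma l2_pythagoras:
  assumes X: "X \<in> borel_measurable M" and e: "orthonormal_basis M X e" and \<phi>: "\<phi> \<in> L2 M X"
  shows "(l2_norm M X (\<lambda>x. \<phi> x - basis_sum e k c x))\<^sup>2 =
    (l2_norm M X (\<lambda>x. \<phi> x - fourier_sum M X e k \<phi> x))\<^sup>2 +
    (\<Sum>j<k. (l2_inner M X \<phi> (e j) - c j)\<^sup>2)"
proof -
  note eL2 = orthonormal_basis_L2[OF e]
  let ?d = "\<lambda>j. l2_inner M X \<phi> (e j) - c j"
  have P: "fourier_sum M X e k \<phi> \<in> L2 M X"
    unfolding fourier_sum_def by (rule basis_sum_L2[OF X eL2])
  have "(\<lambda>x. \<phi> x - basis_sum e k c x) =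
      (\<lambda>x. (\<phi> x - fourier_sum M X e k \<phi> x) + basis_sum e k ?d x)"
    by (auto simp: fourier_sum_def basis_sum_def left_diff_distrib sum_subtractf)
  then show ?thesis
    using l2_norm_add_power2[OF X L2_diff[OF X \<phi> P] basis_sum_L2[OF X eL2, where k = k and c = ?d]]
    by (simp add: fourier_sum_residual_orthogonal[OF X e \<phi>] l2_norm_basis_sum_power2[OF X e])
qed

lemma bessel_inequality:
  assumes X: "X \<in> borel_measurable M" and e: "orthonormal_basis M X e" and \<phi>: "\<phi> \<in> L2 M X"
  shows "(\<Sum>j<k. (l2_inner M X \<phi> (e j))\<^sup>2) \<le> (l2_norm M X \<phi>)\<^sup>2"
  using l2_pythagoras[OF X e \<phi>, where k = k and c = "\<lambda>_. 0"] by (simp add: basis_sum_def)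

text \<open>
  Density provides one good approximant in the span of finitely many basis functions; padding its
  coefficients by zeros makes it a competitor in all larger spans, where the Fourier sum is
  at least as close.
\<close>

lemma fourier_sum_residual_tendsto_0:
  assumes X: "X \<in> borel_measurable M" and e: "orthonormal_basis M X e" and \<phi>: "\<phi> \<in> L2 M X"
  shows "(\<lambda>k. l2_norm M X (\<lambda>x. \<phi> x - fourier_sum M X e k \<phi> x)) \<longlonglongrightarrow> 0"
proof (rule LIMSEQ_I)
  fix \<epsilon> :: real assume "\<epsilon> > 0"
  then have "\<exists>k0. \<exists>\<psi>\<in>l2_span e k0. l2_norm M X (\<lambda>x. \<phi> x - \<psi> x) < \<epsilon>"
    using e \<phi> unfolding orthonormal_basis_def by blast
  then obtain k0 c where c: "l2_norm M X (\<lambda>x. \<phi> x - basis_sum e k0 c x) < \<epsilon>"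
    by (auto simp: l2_span_eq_range)
  have "l2_norm M X (\<lambda>x. \<phi> x - fourier_sum M X e k \<phi> x) < \<epsilon>" if "k0 \<le> k" for k
  proof -
    let ?c = "\<lambda>j. if j < k0 then c j else 0"
    have "{..<k} \<inter> {j. j < k0} = {..<k0}"
      using that by auto
    then have "basis_sum e k0 c = basis_sum e k ?c"
      by (auto simp: basis_sum_def if_distrib[of "\<lambda>a. a * _"] sum.If_cases cong: if_cong)
    then have "(l2_norm M X (\<lambda>x. \<phi> x - fourier_sum M X e k \<phi> x))\<^sup>2
        \<le> (l2_norm M X (\<lambda>x. \<phi> x - basis_sum e k0 c x))\<^sup>2"
      using l2_pythagoras[OF X e \<phi>, where k = k and c = ?c] by (simp add: sum_nonneg)
    then have "l2_norm M X (\<lambda>x. \<phi> x - fourier_sum M X e k \<phi> x)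
        \<le> l2_norm M X (\<lambda>x. \<phi> x - basis_sum e k0 c x)"
      by (rule power2_le_imp_le) (rule l2_norm_nonneg)
    with c show ?thesis by simp
  qed
  then show "\<exists>no. \<forall>k\<ge>no. norm (l2_norm M X (\<lambda>x. \<phi> x - fourier_sum M X e k \<phi> x) - 0) < \<epsilon>"
    by (auto simp: l2_norm_nonneg)
qed

section \<open>The conditional expectation operator\<close>

text \<open>
  The Doob--Dynkin factorization: a function measurable with respect to the sigma-algebra of \<open>W\<close>
  is a function of \<open>W\<close>. For indicators this is the form of the generated sets, and the
  factorization passes through sums, multiples and suprema.
\<close>

lemma doob_dynkin_ennreal:
  fixes u :: "'a \<Rightarrow> ennreal"
  assumes "u \<in> borel_measurable (sigma_gen M W)"
  shows "\<exists>v\<in>borel_measurable borel. \<forall>\<omega>\<in>space M. u \<omega> = v (W \<omega>)"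
  using assms
proof (induction rule: borel_measurable_induct)
  case (cong u u')
  from cong.IH obtain v where "v \<in> borel_measurable borel" "\<forall>\<omega>\<in>space M. u' \<omega> = v (W \<omega>)"
    by blast
  with cong.hyps(3) show ?case
    by (intro bexI[of _ v]) (auto simp: sigma_gen_def)
next
  case (set A)
  then obtain B where "B \<in> sets borel" "A = W -` B \<inter> space M"
    by (auto simp: sigma_gen_def sets_vimage_algebra2)
  then show ?case
    by (intro bexI[of _ "indicator B"]) (auto simp: indicator_def)
next
  case (mult u c)
  from mult.IH obtain v where "v \<in> borel_measurable borel" "\<forall>\<omega>\<in>space M. u \<omega> = v (W \<omega>)"
    by blast
  then show ?case
    by (intro bexI[of _ "\<lambda>x. c * v x"]) auto
next
  case (add u u')
  from add.IH obtain v v' where "v \<in> borel_measurable borel" "\<forall>\<omega>\<in>space M. u \<omega> = v (W \<omega>)"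
    "v' \<in> borel_measurable borel" "\<forall>\<omega>\<in>space M. u' \<omega> = v' (W \<omega>)"
    by blast
  then show ?case
    by (intro bexI[of _ "\<lambda>x. v' x + v x"]) auto
next
  case (seq U)
  from seq.IH obtain v where "\<And>i. v i \<in> borel_measurable borel" "\<And>i. \<forall>\<omega>\<in>space M. U i \<omega> = v i (W \<omega>)"
    by metis
  then show ?case
    by (intro bexI[of _ "\<lambda>x. SUP i. v i x"]) (auto simp: SUP_apply image_comp)
qed

lemma doob_dynkin_real:
  fixes u :: "'a \<Rightarrow> real"
  assumes [measurable]: "u \<in> borel_measurable (sigma_gen M W)"
  shows "\<exists>v\<in>borel_measurable borel. \<forall>\<omega>\<in>space M. u \<omega> = v (W \<omega>)"
proof -
  obtain p where [measurable]: "p \<in> borel_measurable borel"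
    and p: "\<forall>\<omega>\<in>space M. ennreal (u \<omega>) = p (W \<omega>)"
    using doob_dynkin_ennreal[of "\<lambda>\<omega>. ennreal (u \<omega>)" M W] by auto
  obtain q where [measurable]: "q \<in> borel_measurable borel"
    and q: "\<forall>\<omega>\<in>space M. ennreal (- u \<omega>) = q (W \<omega>)"
    using doob_dynkin_ennreal[of "\<lambda>\<omega>. ennreal (- u \<omega>)" M W] by auto
  have "u \<omega> = enn2real (p (W \<omega>)) - enn2real (q (W \<omega>))" if "\<omega> \<in> space M" for \<omega>
    unfolding p[rule_format, OF that, symmetric] q[rule_format, OF that, symmetric]
    by (cases "0 \<le> u \<omega>") (auto simp: ennreal_neg)
  then show ?thesis
    by (intro bexI[of _ "\<lambda>x. enn2real (p x) - enn2real (q x)"]) auto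
qed

lemma (in prob_space) sigma_gen_subalgebra:
  assumes W: "W \<in> borel_measurable M"
  shows "sigma_finite_subalgebra M (sigma_gen M W)" "W \<in> borel_measurable (sigma_gen M W)"
proof -
  have "sets (sigma_gen M W) \<subseteq> sets M"
  proof
    fix A assume "A \<in> sets (sigma_gen M W)"
    then obtain B where "B \<in> sets borel" "A = W -` B \<inter> space M"
      by (auto simp: sigma_gen_def sets_vimage_algebra2)
    then show "A \<in> sets M"
      by (simp add: measurable_sets[OF W])
  qed
  then have "finite_measure_subalgebra M (sigma_gen M W)"
    by (intro finite_measure_subalgebra.intro finite_measure_axioms
        finite_measure_subalgebra_axioms.intro) (simp add: subalgebra_def sigma_gen_def)
  then show "sigma_finite_subalgebra M (sigma_gen M W)"
    by (rule finite_measure_subalgebra_is_sigma_finite)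
  show "W \<in> borel_measurable (sigma_gen M W)"
    using W by (simp add: sigma_gen_def measurable_vimage_algebra1)
qed

text \<open>
  The operator is given by a choice, so its defining property needs a witness: the factor of
  \<open>E[\<phi>(Z) | W]\<close> through \<open>W\<close>, which is square integrable by Jensen's inequality.
\<close>

lemma (in prob_space) cond_exp_op_spec:
  assumes Z[measurable]: "Z \<in> borel_measurable M" and W[measurable]: "W \<in> borel_measurable M"
    and \<phi>: "\<phi> \<in> L2 M Z"
  shows "cond_exp_op M Z W \<phi> \<in> L2 M W"
    and "AE \<omega> in M. cond_exp_op M Z W \<phi> (W \<omega>) =
      real_cond_exp M (sigma_gen M W) (\<lambda>\<omega>. \<phi> (Z \<omega>)) \<omega>"
proof -
  interpret sigma_finite_subalgebra M "sigma_gen M W"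
    by (rule sigma_gen_subalgebra[OF W])
  have [measurable]: "\<phi> \<in> borel_measurable borel"
    by (rule L2_measurable[OF \<phi>])
  obtain v where [measurable]: "v \<in> borel_measurable borel" and v:
    "\<forall>\<omega>\<in>space M. real_cond_exp M (sigma_gen M W) (\<lambda>\<omega>. \<phi> (Z \<omega>)) \<omega> = v (W \<omega>)"
    using doob_dynkin_real[of "real_cond_exp M (sigma_gen M W) (\<lambda>\<omega>. \<phi> (Z \<omega>))" M W] by auto
  have int2: "integrable M (\<lambda>\<omega>. (\<phi> (Z \<omega>))\<^sup>2)"
    using \<phi> by (simp add: L2_def)
  then have "integrable M (\<lambda>\<omega>. \<phi> (Z \<omega>))"
    by (rule square_integrable_imp_integrable[rotated]) simp
  then have "integrable M (\<lambda>\<omega>. (real_cond_exp M (sigma_gen M W) (\<lambda>\<omega>. \<phi> (Z \<omega>)) \<omega>)\<^sup>2)"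
    using int2 by (intro integrable_convex_cond_exp[where I = UNIV]) (auto simp: convex_power2)
  then have "v \<in> L2 M W"
    using v by (simp add: L2_def cong: Bochner_Integration.integrable_cong)
  then have "\<exists>\<psi>. \<psi> \<in> L2 M W \<and> (AE \<omega> in M. \<psi> (W \<omega>) =
      real_cond_exp M (sigma_gen M W) (\<lambda>\<omega>. \<phi> (Z \<omega>)) \<omega>)"
    using v by (auto intro!: exI[of _ v])
  from someI_ex[OF this] show "cond_exp_op M Z W \<phi> \<in> L2 M W"
    and "AE \<omega> in M. cond_exp_op M Z W \<phi> (W \<omega>) =
      real_cond_exp M (sigma_gen M W) (\<lambda>\<omega>. \<phi> (Z \<omega>)) \<omega>"
    unfolding cond_exp_op_def by auto
qed

text \<open>
  Inner products with \<open>T \<phi>\<close> are joint moments of \<open>Z\<close> and \<open>W\<close>. From here on conditional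
  expectations of functions of \<open>Z\<close> enter only through such moments, which are linear in \<open>\<phi>\<close>
  everywhere, whereas the chosen representatives \<open>T \<phi>\<close> are linear only almost surely.
\<close>

lemma (in prob_space) l2_inner_cond_exp_op:
  assumes Z[measurable]: "Z \<in> borel_measurable M" and W[measurable]: "W \<in> borel_measurable M"
    and \<phi>: "\<phi> \<in> L2 M Z" and \<psi>: "\<psi> \<in> L2 M W"
  shows "l2_inner M W (cond_exp_op M Z W \<phi>) \<psi> = expectation (\<lambda>\<omega>. \<phi> (Z \<omega>) * \<psi> (W \<omega>))"
proof -
  interpret sigma_finite_subalgebra M "sigma_gen M W"
    by (rule sigma_gen_subalgebra[OF W])
  note [measurable] = L2_measurable[OF \<phi>] L2_measurable[OF \<psi>]
    L2_measurable[OF cond_exp_op_spec(1)[OF Z W \<phi>]]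
  have \<psi>W: "(\<lambda>\<omega>. \<psi> (W \<omega>)) \<in> borel_measurable (sigma_gen M W)"
    using measurable_compose[OF sigma_gen_subalgebra(2)[OF W] L2_measurable[OF \<psi>]] .
  have "l2_inner M W (cond_exp_op M Z W \<phi>) \<psi> =
      expectation (\<lambda>\<omega>. \<psi> (W \<omega>) * real_cond_exp M (sigma_gen M W) (\<lambda>\<omega>. \<phi> (Z \<omega>)) \<omega>)"
    unfolding l2_inner_def using cond_exp_op_spec(2)[OF Z W \<phi>]
    by (intro integral_cong_AE) (auto elim!: eventually_mono)
  also have "\<dots> = expectation (\<lambda>\<omega>. \<psi> (W \<omega>) * \<phi> (Z \<omega>))"
    by (rule real_cond_exp_intg(2)[OF integrable_L2_mult[OF W Z \<psi> \<phi>] \<psi>W]) simp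
  finally show ?thesis by (simp add: mult.commute)
qed

section \<open>Second moments of sample means and products\<close>

text \<open>
  In the expansion of the square, independence and centring leave only the \<open>n\<close> diagonal terms.
\<close>

lemma (in prob_space) iid_mean_power2:
  fixes X :: "nat \<Rightarrow> 'a \<Rightarrow> real"
  assumes indep: "indep_vars (\<lambda>_. borel) X UNIV"
    and int2: "\<And>i. integrable M (\<lambda>\<omega>. (X i \<omega>)\<^sup>2)"
    and mean: "\<And>i. expectation (X i) = 0"
    and var: "\<And>i. expectation (\<lambda>\<omega>. (X i \<omega>)\<^sup>2) \<le> v"
  shows "integrable M (\<lambda>\<omega>. (1 / real n * (\<Sum>i<n. X i \<omega>))\<^sup>2)"
    and "expectation (\<lambda>\<omega>. (1 / real n * (\<Sum>i<n. X i \<omega>))\<^sup>2) \<le> v / real n"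
proof -
  have rv[measurable]: "X i \<in> borel_measurable M" for i
    using indep by (simp add: indep_vars_def)
  have int: "integrable M (\<lambda>\<omega>. X i \<omega> * X j \<omega>)" for i j
    by (intro integrable_mult_of_squares int2) simp_all
  have expand: "(1 / real n * (\<Sum>i<n. X i \<omega>))\<^sup>2
      = (1 / real n)\<^sup>2 * (\<Sum>i<n. \<Sum>j<n. X i \<omega> * X j \<omega>)" for \<omega>
    unfolding power_mult_distrib power2_eq_square[of "sum _ _"] sum_product ..
  show "integrable M (\<lambda>\<omega>. (1 / real n * (\<Sum>i<n. X i \<omega>))\<^sup>2)"
    unfolding expand using int by simp
  have uncorrelated: "expectation (\<lambda>\<omega>. X i \<omega> * X j \<omega>) = 0" if "i \<noteq> j" for i j
  proof -
    have "integrable M (X k)" for k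
      by (rule square_integrable_imp_integrable) (simp_all add: int2)
    then have "expectation (\<lambda>\<omega>. \<Prod>k\<in>{i, j}. X k \<omega>) = (\<Prod>k\<in>{i, j}. expectation (X k))"
      by (intro indep_vars_lebesgue_integral indep_vars_subset[OF indep]) auto
    then show ?thesis
      using that mean by simp
  qed
  have "expectation (\<lambda>\<omega>. (1 / real n * (\<Sum>i<n. X i \<omega>))\<^sup>2)
      = (1 / real n)\<^sup>2 * (\<Sum>i<n. \<Sum>j<n. expectation (\<lambda>\<omega>. X i \<omega> * X j \<omega>))"
    unfolding expand using int by simp
  also have "(\<Sum>i<n. \<Sum>j<n. expectation (\<lambda>\<omega>. X i \<omega> * X j \<omega>))
      = (\<Sum>i<n. \<Sum>j<n. if j = i then expectation (\<lambda>\<omega>. (X i \<omega>)\<^sup>2) else 0)"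
    using uncorrelated by (intro sum.cong refl) (auto simp: power2_eq_square)
  also have "\<dots> = (\<Sum>i<n. expectation (\<lambda>\<omega>. (X i \<omega>)\<^sup>2))"
    by simp
  also have "(1 / real n)\<^sup>2 * \<dots> \<le> (1 / real n)\<^sup>2 * (\<Sum>i<n. v)"
    by (intro mult_left_mono sum_mono var) simp
  also have "\<dots> = v / real n"
    by (simp add: power2_eq_square)
  finally show "expectation (\<lambda>\<omega>. (1 / real n * (\<Sum>i<n. X i \<omega>))\<^sup>2) \<le> v / real n" .
qed

lemma (in prob_space) iid_sample_mean_power2:
  fixes D :: "nat \<Rightarrow> 'a \<Rightarrow> 'd::topological_space" and F :: "'d \<Rightarrow> real"
  assumes indep: "indep_vars (\<lambda>_. borel) D UNIV"
    and distr: "\<And>i. distr M borel (D i) = distr M borel D0"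
    and D0: "D0 \<in> borel_measurable M" and F: "F \<in> borel_measurable borel"
    and int2: "integrable M (\<lambda>\<omega>. (F (D0 \<omega>))\<^sup>2)"
    and mean: "expectation (\<lambda>\<omega>. F (D0 \<omega>)) = 0"
    and var: "expectation (\<lambda>\<omega>. (F (D0 \<omega>))\<^sup>2) \<le> v"
  shows "integrable M (\<lambda>\<omega>. (1 / real n * (\<Sum>i<n. F (D i \<omega>)))\<^sup>2)"
    and "expectation (\<lambda>\<omega>. (1 / real n * (\<Sum>i<n. F (D i \<omega>)))\<^sup>2) \<le> v / real n"
proof -
  have Di: "D i \<in> borel_measurable M" for i
    using indep by (simp add: indep_vars_def)
  have indep_F: "indep_vars (\<lambda>_. borel) (\<lambda>i \<omega>. F (D i \<omega>)) UNIV"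
    using indep_vars_compose2[OF indep] F by simp
  have F2: "(\<lambda>x. (F x)\<^sup>2) \<in> borel_measurable borel"
    using F by simp
  have int2_i: "integrable M (\<lambda>\<omega>. (F (D i \<omega>))\<^sup>2)" for i
    using int2 integrable_distr_eq[OF Di[of i] F2] integrable_distr_eq[OF D0 F2]
    by (simp add: distr)
  have eq: "expectation (\<lambda>\<omega>. G (D i \<omega>)) = expectation (\<lambda>\<omega>. G (D0 \<omega>))"
    if "G \<in> borel_measurable borel" for i and G :: "'d \<Rightarrow> real"
    using integral_distr[OF Di[of i] that] integral_distr[OF D0 that] by (simp add: distr)
  have mean_i: "expectation (\<lambda>\<omega>. F (D i \<omega>)) = 0" for i
    using eq[OF F] mean by simp
  have var_i: "expectation (\<lambda>\<omega>. (F (D i \<omega>))\<^sup>2) \<le> v" for i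
    using eq[OF F2] var by simp
  show "integrable M (\<lambda>\<omega>. (1 / real n * (\<Sum>i<n. F (D i \<omega>)))\<^sup>2)"
    and "expectation (\<lambda>\<omega>. (1 / real n * (\<Sum>i<n. F (D i \<omega>)))\<^sup>2) \<le> v / real n"
    using iid_mean_power2[OF indep_F int2_i mean_i var_i] by auto
qed

text \<open>
  Conditioning on \<open>X\<close> pulls \<open>\<psi>\<^sup>2(X)\<close> out and leaves \<open>E[V\<^sup>2 | X] \<le> s\<^sup>2\<close>. This is used twice: with
  the noise \<open>V = U\<close> given \<open>W\<close>, and with an instrument \<open>V = f\<^sub>l(W)\<close> given \<open>Z\<close>.
\<close>

lemma (in prob_space) second_moment_le_cond_bound:
  fixes V :: "'a \<Rightarrow> real"
  assumes X[measurable]: "X \<in> borel_measurable M" and V[measurable]: "V \<in> borel_measurable M"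
    and \<psi>: "\<psi> \<in> L2 M X"
    and bound: "AE \<omega> in M. nn_cond_exp M (sigma_gen M X) (\<lambda>\<omega>. ennreal ((V \<omega>)\<^sup>2)) \<omega> \<le> ennreal (s\<^sup>2)"
  shows "integrable M (\<lambda>\<omega>. (\<psi> (X \<omega>) * V \<omega>)\<^sup>2)"
    and "expectation (\<lambda>\<omega>. (\<psi> (X \<omega>) * V \<omega>)\<^sup>2) \<le> s\<^sup>2 * (l2_norm M X \<psi>)\<^sup>2"
proof -
  interpret sigma_finite_subalgebra M "sigma_gen M X"
    by (rule sigma_gen_subalgebra[OF X])
  have [measurable]: "\<psi> \<in> borel_measurable borel"
    by (rule L2_measurable[OF \<psi>])
  have \<psi>X: "(\<lambda>\<omega>. ennreal ((\<psi> (X \<omega>))\<^sup>2)) \<in> borel_measurable (sigma_gen M X)"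
    by (rule measurable_compose[OF sigma_gen_subalgebra(2)[OF X], of "\<lambda>x. ennreal ((\<psi> x)\<^sup>2)"]) simp
  have "(\<integral>\<^sup>+\<omega>. ennreal ((\<psi> (X \<omega>) * V \<omega>)\<^sup>2) \<partial>M)
      = (\<integral>\<^sup>+\<omega>. ennreal ((\<psi> (X \<omega>))\<^sup>2) * ennreal ((V \<omega>)\<^sup>2) \<partial>M)"
    by (simp add: power_mult_distrib ennreal_mult)
  also have "\<dots> = (\<integral>\<^sup>+\<omega>. ennreal ((\<psi> (X \<omega>))\<^sup>2) *
      nn_cond_exp M (sigma_gen M X) (\<lambda>\<omega>. ennreal ((V \<omega>)\<^sup>2)) \<omega> \<partial>M)"
    by (rule nn_cond_exp_intg[symmetric, OF \<psi>X]) simp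
  also have "\<dots> \<le> (\<integral>\<^sup>+\<omega>. ennreal ((\<psi> (X \<omega>))\<^sup>2) * ennreal (s\<^sup>2) \<partial>M)"
    using bound by (intro nn_integral_mono_AE) (auto elim!: eventually_mono intro: mult_left_mono)
  also have "\<dots> = ennreal ((l2_norm M X \<psi>)\<^sup>2) * ennreal (s\<^sup>2)"
    using \<psi> by (simp add: nn_integral_multc nn_integral_eq_integral L2_def l2_norm_power2
        l2_inner_def flip: power2_eq_square)
  also have "\<dots> = ennreal (s\<^sup>2 * (l2_norm M X \<psi>)\<^sup>2)"
    by (simp add: ennreal_mult mult.commute)
  finally have le: "(\<integral>\<^sup>+\<omega>. ennreal ((\<psi> (X \<omega>) * V \<omega>)\<^sup>2) \<partial>M) \<le> ennreal (s\<^sup>2 * (l2_norm M X \<psi>)\<^sup>2)" .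
  show int: "integrable M (\<lambda>\<omega>. (\<psi> (X \<omega>) * V \<omega>)\<^sup>2)"
    using le by (intro integrableI_nonneg) (auto simp: le_less_trans)
  show "expectation (\<lambda>\<omega>. (\<psi> (X \<omega>) * V \<omega>)\<^sup>2) \<le> s\<^sup>2 * (l2_norm M X \<psi>)\<^sup>2"
    using le by (simp add: nn_integral_eq_integral[OF int])
qed

section \<open>The Galerkin solution and its approximation error\<close>

lemma (in prob_space) T_mat_index:
  assumes Z: "Z \<in> borel_measurable M" and W: "W \<in> borel_measurable M"
    and e: "orthonormal_basis M Z e" and f: "orthonormal_basis M W f" and "l < k" "j < k"
  shows "T_mat M Z W e f k $$ (l, j) = expectation (\<lambda>\<omega>. e j (Z \<omega>) * f l (W \<omega>))"
  using assms(5,6) l2_inner_cond_exp_op[OF Z W orthonormal_basis_L2[OF e] orthonormal_basis_L2[OF f]]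
  by (simp add: T_mat_def)

lemma T_mat_carrier [simp]: "T_mat M Z W e f k \<in> carrier_mat k k"
  by (simp add: T_mat_def)

definition moment_vec ::
  "'a measure \<Rightarrow> ('a \<Rightarrow> 'b) \<Rightarrow> ('a \<Rightarrow> 'c) \<Rightarrow> (nat \<Rightarrow> 'c \<Rightarrow> real) \<Rightarrow> nat \<Rightarrow> ('b \<Rightarrow> real) \<Rightarrow> real vec" where
  "moment_vec M Z W f k \<psi> = Matrix.vec k (\<lambda>l. \<integral>\<omega>. \<psi> (Z \<omega>) * f l (W \<omega>) \<partial>M)"

definition galerkin_coeff ::
  "'a measure \<Rightarrow> ('a \<Rightarrow> 'b::euclidean_space) \<Rightarrow> ('a \<Rightarrow> 'c::euclidean_space) \<Rightarrow>
    (nat \<Rightarrow> 'b \<Rightarrow> real) \<Rightarrow> (nat \<Rightarrow> 'c \<Rightarrow> real) \<Rightarrow> nat \<Rightarrow> ('b \<Rightarrow> real) \<Rightarrow> real vec" where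
  "galerkin_coeff M Z W e f k \<psi> = mat_inv (T_mat M Z W e f k) *\<^sub>v moment_vec M Z W f k \<psi>"

text \<open>
  The Galerkin solution of \<open>T x = T \<psi>\<close>. It takes \<open>\<psi>\<close> and not the right-hand side \<open>T \<psi>\<close> as its
  argument, so that it is determined by joint moments and is exactly linear.
\<close>

definition galerkin_sol ::
  "'a measure \<Rightarrow> ('a \<Rightarrow> 'b::euclidean_space) \<Rightarrow> ('a \<Rightarrow> 'c::euclidean_space) \<Rightarrow>
    (nat \<Rightarrow> 'b \<Rightarrow> real) \<Rightarrow> (nat \<Rightarrow> 'c \<Rightarrow> real) \<Rightarrow> nat \<Rightarrow> ('b \<Rightarrow> real) \<Rightarrow> 'b \<Rightarrow> real" where
  "galerkin_sol M Z W e f k \<psi> = basis_sum e k (\<lambda>j. galerkin_coeff M Z W e f k \<psi> $ j)"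

lemma moment_vec_carrier [simp]: "moment_vec M Z W f k \<psi> \<in> carrier_vec k"
  by (simp add: moment_vec_def)

locale galerkin = prob_space M for M :: "'a measure" +
  fixes Z :: "'a \<Rightarrow> 'b::euclidean_space" and W :: "'a \<Rightarrow> 'c::euclidean_space"
    and e :: "nat \<Rightarrow> 'b \<Rightarrow> real" and f :: "nat \<Rightarrow> 'c \<Rightarrow> real"
  assumes Z[measurable]: "Z \<in> borel_measurable M" and W[measurable]: "W \<in> borel_measurable M"
    and e: "orthonormal_basis M Z e" and f: "orthonormal_basis M W f"
    and T_nonsingular: "\<And>k. k \<ge> 1 \<Longrightarrow> invertible_mat (T_mat M Z W e f k)"
begin

abbreviation "T \<equiv> T_mat M Z W e f"
abbreviation "moments \<equiv> moment_vec M Z W f"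
abbreviation "gcoeffs \<equiv> galerkin_coeff M Z W e f"
abbreviation "sol \<equiv> galerkin_sol M Z W e f"
abbreviation "residual k \<psi> \<equiv> (\<lambda>x. \<psi> x - fourier_sum M Z e k \<psi> x)"

lemmas e_L2 = orthonormal_basis_L2[OF e] and f_L2 = orthonormal_basis_L2[OF f]

lemma basis_sum_e_L2: "basis_sum e k c \<in> L2 M Z"
  by (rule basis_sum_L2[OF Z e_L2])

lemma sol_L2: "sol k \<psi> \<in> L2 M Z"
  by (simp add: galerkin_sol_def basis_sum_e_L2)

lemma residual_L2: "\<psi> \<in> L2 M Z \<Longrightarrow> residual k \<psi> \<in> L2 M Z"
  unfolding fourier_sum_def by (rule L2_diff[OF Z _ basis_sum_e_L2])

lemma T_inv:
  assumes "k \<ge> 1"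
  shows "T k * mat_inv (T k) = 1\<^sub>m k" "mat_inv (T k) * T k = 1\<^sub>m k" "mat_inv (T k) \<in> carrier_mat k k"
  using mat_inv_inverse[OF T_mat_carrier T_nonsingular[OF assms]] by auto

lemma gcoeffs_carrier: "k \<ge> 1 \<Longrightarrow> gcoeffs k \<psi> \<in> carrier_vec k"
  unfolding galerkin_coeff_def by (rule mult_mat_vec_carrier[OF T_inv(3) moment_vec_carrier])

lemma moments_add:
  assumes "\<psi> \<in> L2 M Z" "\<psi>' \<in> L2 M Z"
  shows "moments k (\<lambda>x. \<psi> x + \<psi>' x) = moments k \<psi> + moments k \<psi>'"
  using integrable_L2_mult[OF Z W _ f_L2] assms
  by (intro eq_vecI) (auto simp: moment_vec_def distrib_right)

lemma moments_scale: "moments k (\<lambda>x. c * \<psi> x) = c \<cdot>\<^sub>v moments k \<psi>"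
  by (intro eq_vecI) (auto simp: moment_vec_def mult.assoc)

lemma moments_basis_sum: "moments k (basis_sum e k c) = T k *\<^sub>v Matrix.vec k c"
proof (rule eq_vecI)
  fix l assume "l < dim_vec (T k *\<^sub>v Matrix.vec k c)"
  then have l: "l < k" by (simp add: T_mat_def)
  have "moments k (basis_sum e k c) $ l = (\<Sum>j<k. c j * expectation (\<lambda>\<omega>. e j (Z \<omega>) * f l (W \<omega>)))"
    using l integrable_L2_mult[OF Z W e_L2 f_L2]
    by (simp add: moment_vec_def basis_sum_def sum_distrib_right mult.assoc)
  also have "\<dots> = (T k *\<^sub>v Matrix.vec k c) $ l"
    using l T_mat_index[OF Z W e f l]
    by (auto simp: scalar_prod_def atLeast0LessThan mult.commute carrier_matD[OF T_mat_carrier] intro!: sum.cong)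
  finally show "moments k (basis_sum e k c) $ l = (T k *\<^sub>v Matrix.vec k c) $ l" .
qed (simp add: moment_vec_def T_mat_def)

lemma sol_add:
  assumes k: "k \<ge> 1" and "\<psi> \<in> L2 M Z" "\<psi>' \<in> L2 M Z"
  shows "sol k (\<lambda>x. \<psi> x + \<psi>' x) x = sol k \<psi> x + sol k \<psi>' x"
proof -
  have "gcoeffs k (\<lambda>x. \<psi> x + \<psi>' x) = gcoeffs k \<psi> + gcoeffs k \<psi>'"
    unfolding galerkin_coeff_def moments_add[OF assms(2,3)]
    by (rule mult_add_distrib_mat_vec[OF T_inv(3)[OF k]]) simp_all
  then show ?thesis
    using carrier_vecD[OF gcoeffs_carrier[OF k]]
    by (simp add: galerkin_sol_def basis_sum_def distrib_right sum.distrib)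
qed

lemma sol_scale:
  assumes k: "k \<ge> 1"
  shows "sol k (\<lambda>x. c * \<psi> x) = (\<lambda>x. c * sol k \<psi> x)"
proof -
  have "gcoeffs k (\<lambda>x. c * \<psi> x) = c \<cdot>\<^sub>v gcoeffs k \<psi>"
    unfolding galerkin_coeff_def moments_scale
    by (rule mult_mat_vec[OF T_inv(3)[OF k]]) simp
  then show ?thesis
    using carrier_vecD[OF gcoeffs_carrier[OF k]]
    by (simp add: galerkin_sol_def basis_sum_def sum_distrib_left mult.assoc)
qed

lemma sol_basis_sum:
  assumes k: "k \<ge> 1"
  shows "sol k (basis_sum e k c) = basis_sum e k c"
proof -
  have "gcoeffs k (basis_sum e k c) = Matrix.vec k c"
    unfolding galerkin_coeff_def moments_basis_sum using T_inv[OF k]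
    by (subst assoc_mult_mat_vec[symmetric, of _ k k _ k]) auto
  then show ?thesis
    by (simp add: galerkin_sol_def basis_sum_def)
qed

text \<open>
  The defining property of the Galerkin solution: it solves the first \<open>k\<close> moment equations.
\<close>

lemma moments_sol:
  assumes k: "k \<ge> 1"
  shows "moments k (sol k \<psi>) = moments k \<psi>"
proof -
  have "Matrix.vec k (\<lambda>j. gcoeffs k \<psi> $ j) = gcoeffs k \<psi>"
    using carrier_vecD[OF gcoeffs_carrier[OF k]] by (intro eq_vecI) auto
  then have "moments k (sol k \<psi>) = T k *\<^sub>v gcoeffs k \<psi>"
    by (simp add: galerkin_sol_def moments_basis_sum)
  also have "\<dots> = moments k \<psi>"
    unfolding galerkin_coeff_def using T_inv[OF k]
    by (subst assoc_mult_mat_vec[symmetric, of _ k k _ k]) auto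
  finally show ?thesis .
qed

lemma galerkin_orthogonality:
  assumes k: "k \<ge> 1" and \<psi>: "\<psi> \<in> L2 M Z" and "l < k"
  shows "expectation (\<lambda>\<omega>. (\<psi> (Z \<omega>) - sol k \<psi> (Z \<omega>)) * f l (W \<omega>)) = 0"
proof -
  have "moments k (sol k \<psi>) $ l = moments k \<psi> $ l"
    by (simp add: moments_sol[OF k])
  then show ?thesis
    using integrable_L2_mult[OF Z W \<psi> f_L2] integrable_L2_mult[OF Z W sol_L2 f_L2] \<open>l < k\<close>
    by (simp add: moment_vec_def left_diff_distrib)
qed

text \<open>
  The projection onto the span of the first \<open>k\<close> functions \<open>f\<^sub>l\<close> keeps the first \<open>k\<close> moments, and
  those are all that the inverse of the Galerkin matrix reads; so the bias operator is the
  Galerkin solution map applied to \<open>E\<^sub>k\<^sup>\<bottom> \<psi>\<close>.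
\<close>

lemma bias_op_eq_sol_residual:
  assumes k: "k \<ge> 1" and \<psi>: "\<psi> \<in> L2 M Z"
  shows "bias_op M Z W e f k \<psi> = sol k (residual k \<psi>)"
proof -
  let ?\<rho> = "residual k \<psi>"
  let ?T\<rho> = "cond_exp_op M Z W ?\<rho>"
  have T\<rho>: "?T\<rho> \<in> L2 M W"
    by (rule cond_exp_op_spec(1)[OF Z W residual_L2[OF \<psi>]])
  have "l2_inner M W (l2_proj M W f k ?T\<rho>) (f l) = moments k ?\<rho> $ l" if "l < k" for l
    using that l2_inner_basis_sum_basis[OF W f that] l2_inner_cond_exp_op[OF Z W residual_L2[OF \<psi>] f_L2]
    by (simp add: l2_proj_eq_fourier_sum[OF W f T\<rho>] fourier_sum_def[of M W] moment_vec_def)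
  then have "(\<Sum>l<k. mat_inv (T k) $$ (j, l) * l2_inner M W (l2_proj M W f k ?T\<rho>) (f l))
      = gcoeffs k ?\<rho> $ j" if "j < k" for j
    using that carrier_matD[OF T_inv(3)[OF k]]
    by (auto simp: galerkin_coeff_def scalar_prod_def atLeast0LessThan moment_vec_def intro!: sum.cong)
  then show ?thesis
    by (simp add: bias_op_def T_inv_op_def galerkin_sol_def basis_sum_def
        l2_proj_eq_fourier_sum[OF Z e \<psi>])
qed

lemma fourier_sum_scaled_residual:
  assumes \<psi>: "\<psi> \<in> L2 M Z"
  shows "fourier_sum M Z e k (\<lambda>x. c * residual k \<psi> x) = (\<lambda>_. 0)"
proof -
  have "l2_inner M Z (residual k \<psi>) (e j) = 0" if "j < k" for j
    using l2_inner_diff_left[OF Z \<psi> basis_sum_e_L2 e_L2] l2_inner_basis_sum_basis[OF Z e that]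
    by (simp add: fourier_sum_def)
  then show ?thesis
    by (simp add: fourier_sum_def[of _ _ _ _ "\<lambda>x. c * _ x"] basis_sum_def l2_inner_scale_left)
qed

text \<open>
  The solution map reproduces the span, so \<open>\<psi> - \<psi>\<^sub>k = \<rho> - \<rho>\<^sub>k\<close> for the residual \<open>\<rho> = E\<^sub>k\<^sup>\<bottom> \<psi>\<close>, and
  \<open>\<rho>\<^sub>k\<close> is the bias operator at \<open>\<rho>\<close>. The operator norm bounds it by \<open>C \<parallel>\<rho>\<parallel>\<close>.
\<close>

lemma galerkin_error_le:
  assumes k: "k \<ge> 1" and \<psi>: "\<psi> \<in> L2 M Z" and "0 \<le> C"
    and stable: "l2_opnorm M Z (bias_op M Z W e f k) \<le> ennreal C"
  shows "l2_norm M Z (\<lambda>x. \<psi> x - sol k \<psi> x) \<le> (1 + C) * l2_norm M Z (residual k \<psi>)"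
proof -
  let ?\<rho> = "residual k \<psi>"
  let ?r = "l2_norm M Z ?\<rho>"
  note \<rho> = residual_L2[OF \<psi>, of k]
  have bound: "l2_norm M Z (sol k ?\<rho>) \<le> C * (?r + \<epsilon>)" if "\<epsilon> > 0" for \<epsilon>
  proof -
    \<comment> \<open>The slack \<open>\<epsilon>\<close> allows rescaling into the unit ball even when the residual vanishes.\<close>
    define t where "t = 1 / (?r + \<epsilon>)"
    have pos: "?r + \<epsilon> > 0" and t: "t > 0"
      using l2_norm_nonneg[of M Z ?\<rho>] that by (auto simp: t_def)
    have "t * ?r \<le> 1"
      using pos that by (simp add: t_def)
    then have "(\<lambda>x. t * ?\<rho> x) \<in> L2 M Z \<and> l2_norm M Z (\<lambda>x. t * ?\<rho> x) \<le> 1"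
      using L2_scale[OF \<rho>, of t] t unfolding l2_norm_scale by simp
    then have "ennreal (l2_norm M Z (bias_op M Z W e f k (\<lambda>x. t * ?\<rho> x)))
        \<le> l2_opnorm M Z (bias_op M Z W e f k)"
      unfolding l2_opnorm_def by (intro SUP_upper) blast
    from order_trans[OF this stable]
    have "ennreal (l2_norm M Z (bias_op M Z W e f k (\<lambda>x. t * ?\<rho> x))) \<le> ennreal C" .
    moreover have "bias_op M Z W e f k (\<lambda>x. t * ?\<rho> x) = (\<lambda>x. t * sol k ?\<rho> x)"
      using bias_op_eq_sol_residual[OF k L2_scale[OF \<rho>], of t]
      by (simp add: fourier_sum_scaled_residual[OF \<psi>] sol_scale[OF k])
    ultimately have "t * l2_norm M Z (sol k ?\<rho>) \<le> C"
      using \<open>0 \<le> C\<close> t by (simp add: l2_norm_scale)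
    then show ?thesis
      using pos by (simp add: t_def field_simps)
  qed
  have "l2_norm M Z (sol k ?\<rho>) \<le> C * ?r"
  proof (rule field_le_epsilon)
    fix d :: real assume "d > 0"
    then have "C * (?r + d / (C + 1)) \<le> C * ?r + d"
      using \<open>0 \<le> C\<close> by (simp add: field_simps)
    then show "l2_norm M Z (sol k ?\<rho>) \<le> C * ?r + d"
      using bound[of "d / (C + 1)"] \<open>d > 0\<close> \<open>0 \<le> C\<close> by simp
  qed
  moreover have "sol k \<psi> x = sol k ?\<rho> x + fourier_sum M Z e k \<psi> x" for x
  proof -
    let ?p = "basis_sum e k (\<lambda>j. l2_inner M Z \<psi> (e j))"
    have "sol k (\<lambda>x. ?\<rho> x + ?p x) x = sol k ?\<rho> x + sol k ?p x"
      by (rule sol_add[OF k \<rho> basis_sum_e_L2])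
    then show ?thesis
      by (simp add: fourier_sum_def sol_basis_sum[OF k])
  qed
  then have "(\<lambda>x. \<psi> x - sol k \<psi> x) = (\<lambda>x. ?\<rho> x + (-1) * sol k ?\<rho> x)"
    by auto
  then have "l2_norm M Z (\<lambda>x. \<psi> x - sol k \<psi> x) \<le> ?r + l2_norm M Z (sol k ?\<rho>)"
    using l2_norm_triangle[OF Z \<rho> L2_scale[OF sol_L2, of "-1" k ?\<rho>]] l2_norm_scale[of M Z "-1" "sol k ?\<rho>"]
    by simp
  ultimately show ?thesis
    by (simp add: algebra_simps)
qed

end

section \<open>Pointwise error bound for the estimator\<close>

lemma square_add_le: "(x + y)\<^sup>2 \<le> 2 * x\<^sup>2 + 2 * y\<^sup>2" for x y :: real
  using zero_le_power2[of "x - y"] by (simp add: power2_sum power2_diff)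

lemma T_hat_carrier [simp]: "T_hat e f k n z w \<in> carrier_mat k k"
  by (simp add: T_hat_def)

text \<open>
  The three terms on the right are, in order, the stochastic error, the approximation error, and
  the price of the thresholding. The last one dominates \<open>L\<^sup>2\<close> whenever the estimator is set to
  zero, because then \<open>a\<^sup>2 \<parallel>B - A\<parallel>\<^sup>2 > 1\<close> in Frobenius norm. The bound holds for every realization of
  the data, so integrating it only involves the measurability of the right-hand side.
\<close>

lemma ell_hat_error_le:
  fixes L a :: real and e :: "nat \<Rightarrow> 'b \<Rightarrow> real" and f :: "nat \<Rightarrow> 'c \<Rightarrow> real"
    and k n :: nat and y :: "nat \<Rightarrow> real" and z :: "nat \<Rightarrow> 'b" and w :: "nat \<Rightarrow> 'c"
  assumes A: "A \<in> carrier_mat k k" "invertible_mat A"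
    and a: "2 * mat_opnorm (mat_inv A) \<le> a"
    and hv: "hv \<in> carrier_vec k" and c: "c \<in> carrier_vec k"
  defines "B \<equiv> T_hat e f k n z w"
  shows "(ell_hat e f hv k a n y z w - L)\<^sup>2
    \<le> 2 * (vec_norm2 hv * a)\<^sup>2 * (vec_norm2 (g_hat f k n y w - B *\<^sub>v c))\<^sup>2
      + 2 * (hv \<bullet> c - L)\<^sup>2 + L\<^sup>2 * (a\<^sup>2 * frobenius_sq (B - A))"
proof (cases "invertible_mat B \<and> mat_opnorm (mat_inv B) \<le> a")
  case True
  let ?V = "g_hat f k n y w - B *\<^sub>v c"
  have B: "B \<in> carrier_mat k k" and g: "g_hat f k n y w \<in> carrier_vec k"
    by (simp_all add: B_def g_hat_def)
  then have Bc: "B *\<^sub>v c \<in> carrier_vec k" and V: "?V \<in> carrier_vec k"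
    using c by auto
  note Binv = mat_inv_inverse[OF B conjunct1[OF True]]
  have BV: "mat_inv B *\<^sub>v ?V \<in> carrier_vec k"
    using Binv(3) V by simp
  have "mat_inv B *\<^sub>v ?V = mat_inv B *\<^sub>v g_hat f k n y w - mat_inv B *\<^sub>v (B *\<^sub>v c)"
    using Binv(3) g Bc by (rule mult_minus_distrib_mat_vec)
  also have "mat_inv B *\<^sub>v (B *\<^sub>v c) = c"
    using Binv B c by (simp flip: assoc_mult_mat_vec)
  finally have "mat_inv B *\<^sub>v g_hat f k n y w = mat_inv B *\<^sub>v ?V + c"
    using Binv(3) g c by (intro eq_vecI) auto
  then have "ell_hat e f hv k a n y z w = hv \<bullet> (mat_inv B *\<^sub>v ?V) + hv \<bullet> c"
    using True hv BV c by (simp add: ell_hat_def scalar_prod_add_distrib flip: B_def)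
  then have "(ell_hat e f hv k a n y z w - L)\<^sup>2 = (hv \<bullet> (mat_inv B *\<^sub>v ?V) + (hv \<bullet> c - L))\<^sup>2"
    by (simp add: add_diff_eq)
  also have "\<dots> \<le> 2 * (hv \<bullet> (mat_inv B *\<^sub>v ?V))\<^sup>2 + 2 * (hv \<bullet> c - L)\<^sup>2"
    by (rule square_add_le)
  also have "(hv \<bullet> (mat_inv B *\<^sub>v ?V))\<^sup>2 \<le> (vec_norm2 hv * a)\<^sup>2 * (vec_norm2 ?V)\<^sup>2"
  proof -
    have "vec_norm2 (mat_inv B *\<^sub>v ?V) \<le> mat_opnorm (mat_inv B) * vec_norm2 ?V"
      by (rule vec_norm2_mult_le_opnorm[OF Binv(3) V])
    also have "\<dots> \<le> a * vec_norm2 ?V"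
      using True by (intro mult_right_mono) auto
    finally have BV_le: "vec_norm2 (mat_inv B *\<^sub>v ?V) \<le> a * vec_norm2 ?V" .
    have "\<bar>hv \<bullet> (mat_inv B *\<^sub>v ?V)\<bar> \<le> vec_norm2 hv * vec_norm2 (mat_inv B *\<^sub>v ?V)"
      by (rule abs_scalar_prod_le[OF hv BV])
    also have "\<dots> \<le> vec_norm2 hv * (a * vec_norm2 ?V)"
      by (rule mult_left_mono[OF BV_le vec_norm2_nonneg])
    finally have "\<bar>hv \<bullet> (mat_inv B *\<^sub>v ?V)\<bar>\<^sup>2 \<le> (vec_norm2 hv * (a * vec_norm2 ?V))\<^sup>2"
      by (rule power_mono) simp
    then show ?thesis
      by (simp add: power_mult_distrib mult.assoc)
  qed
  finally have "(ell_hat e f hv k a n y z w - L)\<^sup>2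
      \<le> 2 * (vec_norm2 hv * a)\<^sup>2 * (vec_norm2 ?V)\<^sup>2 + 2 * (hv \<bullet> c - L)\<^sup>2"
    by (simp add: mult.assoc)
  moreover have "0 \<le> L\<^sup>2 * (a\<^sup>2 * frobenius_sq (B - A))"
    by simp
  ultimately show ?thesis by linarith
next
  case False
  have "0 \<le> a"
    using a mat_opnorm_nonneg[of "mat_inv A"] by simp
  have B: "B \<in> carrier_mat k k"
    by (simp add: B_def)
  have "1 < a\<^sup>2 * frobenius_sq (B - A)"
  proof (rule ccontr)
    assume "\<not> ?thesis"
    then have "a\<^sup>2 * frobenius_sq (B - A) \<le> 1"
      by simp
    from mat_inv_perturbation[OF A(1) B A(2) a this \<open>0 \<le> a\<close>] False show False
      by blast
  qed
  then have "L\<^sup>2 * 1 \<le> L\<^sup>2 * (a\<^sup>2 * frobenius_sq (B - A))"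
    by (intro mult_left_mono) auto
  moreover have "ell_hat e f hv k a n y z w = 0"
    using False by (auto simp: ell_hat_def B_def)
  ultimately show ?thesis by (simp add: add_increasing)
qed

section \<open>Moments in the instrumental variable model\<close>

locale npiv_model = galerkin M Z W e f
  for M :: "'a measure" and Z :: "'a \<Rightarrow> 'b::euclidean_space" and W :: "'a \<Rightarrow> 'c::euclidean_space"
    and e f +
  fixes Y U :: "'a \<Rightarrow> real"
    and Ys :: "nat \<Rightarrow> 'a \<Rightarrow> real" and Zs :: "nat \<Rightarrow> 'a \<Rightarrow> 'b" and Ws :: "nat \<Rightarrow> 'a \<Rightarrow> 'c"
    and \<phi> :: "'b \<Rightarrow> real" and \<sigma> \<eta> :: real
  assumes Y[measurable]: "Y \<in> borel_measurable M" and U[measurable]: "U \<in> borel_measurable M"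
    and sample_indep: "indep_vars (\<lambda>_. borel) (\<lambda>i \<omega>. (Ys i \<omega>, Zs i \<omega>, Ws i \<omega>)) UNIV"
    and sample_distr: "\<And>i. distr M borel (\<lambda>\<omega>. (Ys i \<omega>, Zs i \<omega>, Ws i \<omega>)) =
                           distr M borel (\<lambda>\<omega>. (Y \<omega>, Z \<omega>, W \<omega>))"
    and \<phi>_L2: "\<phi> \<in> L2 M Z"
    and model: "AE \<omega> in M. Y \<omega> = \<phi> (Z \<omega>) + U \<omega>"
    and U_exogenous: "AE \<omega> in M. real_cond_exp M (sigma_gen M W) U \<omega> = 0"
    and U_var: "AE \<omega> in M. nn_cond_exp M (sigma_gen M W) (\<lambda>\<omega>. ennreal ((U \<omega>)\<^sup>2)) \<omega> \<le> ennreal (\<sigma>\<^sup>2)"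
    and f_bound: "\<And>j. AE \<omega> in M.
          nn_cond_exp M (sigma_gen M Z) (\<lambda>\<omega>. ennreal ((f j (W \<omega>))\<^sup>2)) \<omega> \<le> ennreal (\<eta>\<^sup>2)"
    and ef_square_integrable: "\<And>j l. integrable M (\<lambda>\<omega>. (e j (Z \<omega>) * f l (W \<omega>))\<^sup>2)"
    and ef_variance: "\<And>j l. variance (\<lambda>\<omega>. e j (Z \<omega>) * f l (W \<omega>)) \<le> \<eta>\<^sup>2"
begin

lemma e_measurable [measurable]: "e j \<in> borel_measurable borel"
  by (rule L2_measurable[OF e_L2])

lemma f_measurable [measurable]: "f l \<in> borel_measurable borel"
  by (rule L2_measurable[OF f_L2])

lemma l2_norm_f: "l2_norm M W (f l) = 1"
  using f by (simp add: l2_norm_def orthonormal_basis_def)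

lemma fU_square:
  "integrable M (\<lambda>\<omega>. (f l (W \<omega>) * U \<omega>)\<^sup>2)"
  "expectation (\<lambda>\<omega>. (f l (W \<omega>) * U \<omega>)\<^sup>2) \<le> \<sigma>\<^sup>2"
  using second_moment_le_cond_bound[OF W U f_L2 U_var, of l] by (simp_all add: l2_norm_f)

lemma fU_mean: "integrable M (\<lambda>\<omega>. f l (W \<omega>) * U \<omega>)" "expectation (\<lambda>\<omega>. f l (W \<omega>) * U \<omega>) = 0"
proof -
  interpret sigma_finite_subalgebra M "sigma_gen M W"
    by (rule sigma_gen_subalgebra[OF W])
  show int: "integrable M (\<lambda>\<omega>. f l (W \<omega>) * U \<omega>)"
    by (rule square_integrable_imp_integrable[OF _ fU_square(1)]) simp
  have "(\<lambda>\<omega>. f l (W \<omega>)) \<in> borel_measurable (sigma_gen M W)"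
    by (rule measurable_compose[OF sigma_gen_subalgebra(2)[OF W] f_measurable])
  then have "expectation (\<lambda>\<omega>. f l (W \<omega>) * U \<omega>)
      = expectation (\<lambda>\<omega>. f l (W \<omega>) * real_cond_exp M (sigma_gen M W) U \<omega>)"
    by (rule real_cond_exp_intg(2)[symmetric, OF int]) simp
  also have "\<dots> = expectation (\<lambda>\<omega>. 0)"
    using U_exogenous by (intro integral_cong_AE) (auto elim!: eventually_mono)
  finally show "expectation (\<lambda>\<omega>. f l (W \<omega>) * U \<omega>) = 0" by simp
qed

lemma moment_residual_decomposition:
  "AE \<omega> in M. f l (W \<omega>) * (Y \<omega> - \<psi> (Z \<omega>)) =
    f l (W \<omega>) * U \<omega> + (\<phi> (Z \<omega>) - \<psi> (Z \<omega>)) * f l (W \<omega>)"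
  using model by eventually_elim (simp add: algebra_simps)

lemma moment_residual_mean:
  assumes \<psi>: "\<psi> \<in> L2 M Z"
  shows "expectation (\<lambda>\<omega>. f l (W \<omega>) * (Y \<omega> - \<psi> (Z \<omega>)))
    = expectation (\<lambda>\<omega>. (\<phi> (Z \<omega>) - \<psi> (Z \<omega>)) * f l (W \<omega>))"
proof -
  note [measurable] = L2_measurable[OF \<psi>] L2_measurable[OF \<phi>_L2]
  have "expectation (\<lambda>\<omega>. f l (W \<omega>) * (Y \<omega> - \<psi> (Z \<omega>)))
      = expectation (\<lambda>\<omega>. f l (W \<omega>) * U \<omega> + (\<phi> (Z \<omega>) - \<psi> (Z \<omega>)) * f l (W \<omega>))"
    by (intro integral_cong_AE moment_residual_decomposition) simp_all
  also have "\<dots> = expectation (\<lambda>\<omega>. (\<phi> (Z \<omega>) - \<psi> (Z \<omega>)) * f l (W \<omega>))"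
    using fU_mean integrable_L2_mult[OF Z W L2_diff[OF Z \<phi>_L2 \<psi>] f_L2] by simp
  finally show ?thesis .
qed

text \<open>
  The residual is the noise term \<open>f\<^sub>l(W) U\<close> plus the approximation term \<open>(\<phi> - \<psi>)(Z) f\<^sub>l(W)\<close>; the
  conditional second moments of \<open>U\<close> given \<open>W\<close> and of \<open>f\<^sub>l(W)\<close> given \<open>Z\<close> control one each.
\<close>

lemma moment_residual_square:
  assumes \<psi>: "\<psi> \<in> L2 M Z"
  shows "integrable M (\<lambda>\<omega>. (f l (W \<omega>) * (Y \<omega> - \<psi> (Z \<omega>)))\<^sup>2)"
    and "expectation (\<lambda>\<omega>. (f l (W \<omega>) * (Y \<omega> - \<psi> (Z \<omega>)))\<^sup>2)
      \<le> 2 * (\<sigma>\<^sup>2 + \<eta>\<^sup>2 * (l2_norm M Z (\<lambda>x. \<phi> x - \<psi> x))\<^sup>2)"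
proof -
  note [measurable] = L2_measurable[OF \<psi>] L2_measurable[OF \<phi>_L2]
  note \<delta> = L2_diff[OF Z \<phi>_L2 \<psi>]
  have fW: "(\<lambda>\<omega>. f l (W \<omega>)) \<in> borel_measurable M" by simp
  note approx = second_moment_le_cond_bound[OF Z fW \<delta> f_bound]
  let ?R = "\<lambda>\<omega>. (f l (W \<omega>) * (Y \<omega> - \<psi> (Z \<omega>)))\<^sup>2"
  let ?B = "\<lambda>\<omega>. 2 * (f l (W \<omega>) * U \<omega>)\<^sup>2 + 2 * ((\<phi> (Z \<omega>) - \<psi> (Z \<omega>)) * f l (W \<omega>))\<^sup>2"
  have le: "AE \<omega> in M. ?R \<omega> \<le> ?B \<omega>"
    using moment_residual_decomposition[of l \<psi>]
    by eventually_elim (simp only: square_add_le)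
  note i1 = integrable_mult_right[of 2, OF fU_square(1)[of l]]
    and i2 = integrable_mult_right[of 2, OF approx(1)]
  note B = Bochner_Integration.integrable_add[OF i1 i2]
  show R: "integrable M ?R"
  proof (rule Bochner_Integration.integrable_bound[OF B])
    show "AE \<omega> in M. norm (?R \<omega>) \<le> norm (?B \<omega>)"
      using le by eventually_elim (metis abs_ge_self abs_power2 order_trans real_norm_def)
  qed simp
  have "expectation ?R \<le> expectation ?B"
    by (rule integral_mono_AE[OF R B le])
  also have "\<dots> = 2 * expectation (\<lambda>\<omega>. (f l (W \<omega>) * U \<omega>)\<^sup>2)
      + 2 * expectation (\<lambda>\<omega>. ((\<phi> (Z \<omega>) - \<psi> (Z \<omega>)) * f l (W \<omega>))\<^sup>2)"
    unfolding Bochner_Integration.integral_add[OF i1 i2] integral_mult_right_zero ..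
  also have "\<dots> \<le> 2 * (\<sigma>\<^sup>2 + \<eta>\<^sup>2 * (l2_norm M Z (\<lambda>x. \<phi> x - \<psi> x))\<^sup>2)"
    unfolding distrib_left using fU_square(2)[of l] approx(2) by linarith
  finally show "expectation ?R \<le> 2 * (\<sigma>\<^sup>2 + \<eta>\<^sup>2 * (l2_norm M Z (\<lambda>x. \<phi> x - \<psi> x))\<^sup>2)" .
qed

text \<open>
  By the moment formula for the entries of the Galerkin matrix, each deviation is the sample mean
  of a centred product \<open>e\<^sub>j(Z) f\<^sub>l(W)\<close>.
\<close>

lemma T_hat_entry_square:
  assumes "n \<ge> 1" "l < k" "j < k"
  shows "integrable M (\<lambda>\<omega>. ((T_hat e f k n (\<lambda>i. Zs i \<omega>) (\<lambda>i. Ws i \<omega>) - T k) $$ (l, j))\<^sup>2)"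
    and "expectation (\<lambda>\<omega>. ((T_hat e f k n (\<lambda>i. Zs i \<omega>) (\<lambda>i. Ws i \<omega>) - T k) $$ (l, j))\<^sup>2)
      \<le> \<eta>\<^sup>2 / real n"
proof -
  let ?t = "T k $$ (l, j)"
  define F where "F = (\<lambda>(y :: real, z, w). f l w * e j z - ?t)"
  have F: "F \<in> borel_measurable borel"
    unfolding F_def borel_prod[symmetric] by measurable
  have D0: "(\<lambda>\<omega>. (Y \<omega>, Z \<omega>, W \<omega>)) \<in> borel_measurable M"
    by simp
  have t: "?t = expectation (\<lambda>\<omega>. e j (Z \<omega>) * f l (W \<omega>))"
    using T_mat_index[OF Z W e f assms(2,3)] .
  have int: "integrable M (\<lambda>\<omega>. e j (Z \<omega>) * f l (W \<omega>))"
    by (rule integrable_L2_mult[OF Z W e_L2 f_L2])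
  have F0: "F (Y \<omega>, Z \<omega>, W \<omega>) = e j (Z \<omega>) * f l (W \<omega>) - ?t" for \<omega>
    by (simp add: F_def mult.commute)
  have "integrable M (\<lambda>\<omega>. (F (Y \<omega>, Z \<omega>, W \<omega>))\<^sup>2)"
    using ef_square_integrable[of j l] int by (simp add: F0 power2_diff)
  moreover have "expectation (\<lambda>\<omega>. F (Y \<omega>, Z \<omega>, W \<omega>)) = 0"
    using int by (simp add: F0 t prob_space)
  moreover have "expectation (\<lambda>\<omega>. (F (Y \<omega>, Z \<omega>, W \<omega>))\<^sup>2) \<le> \<eta>\<^sup>2"
    using ef_variance[of j l] by (simp add: F0 t)
  ultimately have *:
    "integrable M (\<lambda>\<omega>. (1 / real n * (\<Sum>i<n. F (Ys i \<omega>, Zs i \<omega>, Ws i \<omega>)))\<^sup>2)"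
    "expectation (\<lambda>\<omega>. (1 / real n * (\<Sum>i<n. F (Ys i \<omega>, Zs i \<omega>, Ws i \<omega>)))\<^sup>2) \<le> \<eta>\<^sup>2 / real n"
    using iid_sample_mean_power2[OF sample_indep sample_distr D0 F] by auto
  have eq: "(T_hat e f k n (\<lambda>i. Zs i \<omega>) (\<lambda>i. Ws i \<omega>) - T k) $$ (l, j)
      = 1 / real n * (\<Sum>i<n. F (Ys i \<omega>, Zs i \<omega>, Ws i \<omega>))" for \<omega>
    using assms
    by (simp add: T_hat_def F_def sum_subtractf carrier_matD[OF T_mat_carrier] diff_divide_distrib)
  show "integrable M (\<lambda>\<omega>. ((T_hat e f k n (\<lambda>i. Zs i \<omega>) (\<lambda>i. Ws i \<omega>) - T k) $$ (l, j))\<^sup>2)"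
    "expectation (\<lambda>\<omega>. ((T_hat e f k n (\<lambda>i. Zs i \<omega>) (\<lambda>i. Ws i \<omega>) - T k) $$ (l, j))\<^sup>2)
      \<le> \<eta>\<^sup>2 / real n"
    unfolding eq by (fact *)+
qed

lemma T_hat_frobenius:
  assumes n: "n \<ge> 1"
  shows "integrable M (\<lambda>\<omega>. frobenius_sq (T_hat e f k n (\<lambda>i. Zs i \<omega>) (\<lambda>i. Ws i \<omega>) - T k))"
    and "expectation (\<lambda>\<omega>. frobenius_sq (T_hat e f k n (\<lambda>i. Zs i \<omega>) (\<lambda>i. Ws i \<omega>) - T k))
      \<le> (real k)\<^sup>2 * \<eta>\<^sup>2 / real n"
proof -
  let ?X = "\<lambda>l j \<omega>. ((T_hat e f k n (\<lambda>i. Zs i \<omega>) (\<lambda>i. Ws i \<omega>) - T k) $$ (l, j))\<^sup>2"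
  have eq: "frobenius_sq (T_hat e f k n (\<lambda>i. Zs i \<omega>) (\<lambda>i. Ws i \<omega>) - T k)
      = (\<Sum>l<k. \<Sum>j<k. ?X l j \<omega>)" for \<omega>
    by (simp add: frobenius_sq_def carrier_matD[OF T_mat_carrier])
  have int: "integrable M (\<lambda>\<omega>. \<Sum>j<k. ?X l j \<omega>)" if "l < k" for l
    using that T_hat_entry_square(1)[OF n] by (intro Bochner_Integration.integrable_sum) simp
  show "integrable M (\<lambda>\<omega>. frobenius_sq (T_hat e f k n (\<lambda>i. Zs i \<omega>) (\<lambda>i. Ws i \<omega>) - T k))"
    unfolding eq by (rule Bochner_Integration.integrable_sum, rule int) simp
  have "expectation (\<lambda>\<omega>. \<Sum>l<k. \<Sum>j<k. ?X l j \<omega>) = (\<Sum>l<k. expectation (\<lambda>\<omega>. \<Sum>j<k. ?X l j \<omega>))"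
    using int by (intro Bochner_Integration.integral_sum) simp
  also have "\<dots> = (\<Sum>l<k. \<Sum>j<k. expectation (?X l j))"
    using T_hat_entry_square(1)[OF n]
    by (intro sum.cong refl Bochner_Integration.integral_sum) simp
  also have "\<dots> \<le> (\<Sum>l<k. \<Sum>j<k. \<eta>\<^sup>2 / real n)"
    using T_hat_entry_square(2)[OF n] by (intro sum_mono) simp
  also have "\<dots> = (real k)\<^sup>2 * \<eta>\<^sup>2 / real n"
    by (simp add: power2_eq_square)
  finally show "expectation (\<lambda>\<omega>. frobenius_sq (T_hat e f k n (\<lambda>i. Zs i \<omega>) (\<lambda>i. Ws i \<omega>) - T k))
      \<le> (real k)\<^sup>2 * \<eta>\<^sup>2 / real n"
    unfolding eq .
qed

abbreviation "defect k n \<omega> \<equiv> g_hat f k n (\<lambda>i. Ys i \<omega>) (\<lambda>i. Ws i \<omega>)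
  - T_hat e f k n (\<lambda>i. Zs i \<omega>) (\<lambda>i. Ws i \<omega>) *\<^sub>v gcoeffs k \<phi>"

lemma defect_eq:
  assumes k: "k \<ge> 1" and "l < k"
  shows "defect k n \<omega> $ l
    = 1 / real n * (\<Sum>i<n. f l (Ws i \<omega>) * (Ys i \<omega> - sol k \<phi> (Zs i \<omega>)))"
proof -
  have "(T_hat e f k n (\<lambda>i. Zs i \<omega>) (\<lambda>i. Ws i \<omega>) *\<^sub>v gcoeffs k \<phi>) $ l
      = (\<Sum>j<k. 1 / real n * (\<Sum>i<n. f l (Ws i \<omega>) * e j (Zs i \<omega>)) * gcoeffs k \<phi> $ j)"
    using \<open>l < k\<close> carrier_vecD[OF gcoeffs_carrier[OF k]]
    by (simp add: T_hat_def scalar_prod_def atLeast0LessThan)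
  also have "\<dots> = 1 / real n * (\<Sum>j<k. \<Sum>i<n. f l (Ws i \<omega>) * (gcoeffs k \<phi> $ j * e j (Zs i \<omega>)))"
    by (simp add: sum_distrib_left sum_distrib_right mult_ac)
  also have "\<dots> = 1 / real n * (\<Sum>i<n. f l (Ws i \<omega>) * sol k \<phi> (Zs i \<omega>))"
    by (subst sum.swap) (simp add: galerkin_sol_def basis_sum_def sum_distrib_left)
  finally show ?thesis
    using \<open>l < k\<close>
    by (simp add: g_hat_def T_hat_def right_diff_distrib sum_subtractf diff_divide_distrib mult.commute)
qed

text \<open>
  Each entry of the defect is the sample mean of \<open>f\<^sub>l(W) (Y - \<phi>\<^sub>k(Z))\<close>, which is centred by
  exogeneity of the noise and Galerkin orthogonality.
\<close>

lemma defect_square: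
  assumes k: "k \<ge> 1"
  shows "integrable M (\<lambda>\<omega>. (vec_norm2 (defect k n \<omega>))\<^sup>2)"
    and "expectation (\<lambda>\<omega>. (vec_norm2 (defect k n \<omega>))\<^sup>2)
      \<le> real k * (2 * (\<sigma>\<^sup>2 + \<eta>\<^sup>2 * (l2_norm M Z (\<lambda>x. \<phi> x - sol k \<phi> x))\<^sup>2)) / real n"
proof -
  let ?v = "2 * (\<sigma>\<^sup>2 + \<eta>\<^sup>2 * (l2_norm M Z (\<lambda>x. \<phi> x - sol k \<phi> x))\<^sup>2)"
  have [measurable]: "sol k \<phi> \<in> borel_measurable borel"
    by (rule L2_measurable[OF sol_L2])
  have entry: "integrable M (\<lambda>\<omega>. (defect k n \<omega> $ l)\<^sup>2)"
    "expectation (\<lambda>\<omega>. (defect k n \<omega> $ l)\<^sup>2) \<le> ?v / real n" if "l < k" for l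
  proof -
    define F where "F = (\<lambda>(y, z, w). f l w * (y - sol k \<phi> z))"
    have F: "F \<in> borel_measurable borel"
      unfolding F_def borel_prod[symmetric] by measurable
    have D0: "(\<lambda>\<omega>. (Y \<omega>, Z \<omega>, W \<omega>)) \<in> borel_measurable M"
      by simp
    have "expectation (\<lambda>\<omega>. f l (W \<omega>) * (Y \<omega> - sol k \<phi> (Z \<omega>))) = 0"
      by (simp add: moment_residual_mean[OF sol_L2] galerkin_orthogonality[OF k \<phi>_L2 that])
    then show "integrable M (\<lambda>\<omega>. (defect k n \<omega> $ l)\<^sup>2)"
      "expectation (\<lambda>\<omega>. (defect k n \<omega> $ l)\<^sup>2) \<le> ?v / real n"
      using iid_sample_mean_power2[OF sample_indep sample_distr D0 F, of ?v n]
        moment_residual_square[OF sol_L2, of l k \<phi>]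
      unfolding defect_eq[OF k that] F_def by auto
  qed
  have eq: "(vec_norm2 (defect k n \<omega>))\<^sup>2 = (\<Sum>l<k. (defect k n \<omega> $ l)\<^sup>2)" for \<omega>
    by (simp add: vec_norm2_power2 carrier_matD[OF T_hat_carrier])
  show "integrable M (\<lambda>\<omega>. (vec_norm2 (defect k n \<omega>))\<^sup>2)"
    unfolding eq using entry(1) by (intro Bochner_Integration.integrable_sum) simp
  have "expectation (\<lambda>\<omega>. \<Sum>l<k. (defect k n \<omega> $ l)\<^sup>2) = (\<Sum>l<k. expectation (\<lambda>\<omega>. (defect k n \<omega> $ l)\<^sup>2))"
    using entry(1) by (intro Bochner_Integration.integral_sum) simp
  also have "\<dots> \<le> (\<Sum>l<k. ?v / real n)"
    using entry(2) by (intro sum_mono) simp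
  finally show "expectation (\<lambda>\<omega>. (vec_norm2 (defect k n \<omega>))\<^sup>2) \<le> real k * ?v / real n"
    unfolding eq by simp
qed

text \<open>
  The finite-sample form of the theorem. Bessel's inequality replaces the truncated coefficient
  vector of \<open>h\<close> by \<open>\<parallel>h\<parallel>\<close>, and the approximation error is \<open>\<langle>h, \<phi> - \<phi>\<^sub>k\<rangle>\<close> because \<open>\<phi>\<^sub>k\<close> lies in the
  span of the first \<open>k\<close> basis functions.
\<close>

lemma risk_bound:
  assumes k: "k \<ge> 1" and n: "n \<ge> 1" and h: "h \<in> L2 M Z"
    and a: "2 * mat_opnorm (mat_inv (T k)) \<le> a"
  defines "H \<equiv> l2_norm M Z h" and "L \<equiv> l2_inner M Z h \<phi>"
    and "\<delta> \<equiv> l2_norm M Z (\<lambda>x. \<phi> x - sol k \<phi> x)"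
  shows "(\<integral>\<^sup>+ \<omega>. ennreal ((ell_hat e f (coeff_vec M Z e k h) k a n
            (\<lambda>i. Ys i \<omega>) (\<lambda>i. Zs i \<omega>) (\<lambda>i. Ws i \<omega>) - L)\<^sup>2) \<partial>M)
    \<le> ennreal (4 * H\<^sup>2 * (\<sigma>\<^sup>2 + \<eta>\<^sup>2 * \<delta>\<^sup>2) * (real k * a\<^sup>2 / real n) + 2 * (H * \<delta>)\<^sup>2
        + L\<^sup>2 * \<eta>\<^sup>2 * ((real k)\<^sup>2 * a\<^sup>2 / real n))"
proof -
  let ?h = "coeff_vec M Z e k h" and ?c = "gcoeffs k \<phi>"
  let ?F = "\<lambda>\<omega>. frobenius_sq (T_hat e f k n (\<lambda>i. Zs i \<omega>) (\<lambda>i. Ws i \<omega>) - T k)"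
  let ?V = "\<lambda>\<omega>. (vec_norm2 (defect k n \<omega>))\<^sup>2"
  let ?B = "\<lambda>\<omega>. 2 * (H * a)\<^sup>2 * ?V \<omega> + 2 * (H * \<delta>)\<^sup>2 + L\<^sup>2 * (a\<^sup>2 * ?F \<omega>)"
  have "0 \<le> a"
    using a mat_opnorm_nonneg[of "mat_inv (T k)"] by simp
  have "0 \<le> H"
    by (simp add: H_def l2_norm_nonneg)
  have hc: "?h \<in> carrier_vec k"
    by (simp add: coeff_vec_def)
  have "(vec_norm2 ?h)\<^sup>2 \<le> H\<^sup>2"
    using bessel_inequality[OF Z e h] by (simp add: vec_norm2_power2 coeff_vec_def H_def)
  then have Ha: "(vec_norm2 ?h * a)\<^sup>2 \<le> (H * a)\<^sup>2"
    by (simp add: power_mult_distrib mult_right_mono)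
  have "?h \<bullet> ?c = l2_inner M Z (sol k \<phi>) h"
    using l2_inner_basis_sum_left[OF Z e_L2 h] carrier_vecD[OF gcoeffs_carrier[OF k]]
    by (simp add: galerkin_sol_def coeff_vec_def scalar_prod_def atLeast0LessThan
        l2_inner_commute[of M Z _ h] mult.commute)
  then have "L - ?h \<bullet> ?c = l2_inner M Z (\<lambda>x. \<phi> x - sol k \<phi> x) h"
    by (simp add: L_def l2_inner_diff_left[OF Z \<phi>_L2 sol_L2 h] l2_inner_commute[of M Z \<phi> h])
  then have "\<bar>?h \<bullet> ?c - L\<bar> \<le> H * \<delta>"
    using l2_cauchy_schwarz[OF Z L2_diff[OF Z \<phi>_L2 sol_L2] h]
    by (simp add: H_def \<delta>_def abs_minus_commute mult.commute)
  then have bias: "(?h \<bullet> ?c - L)\<^sup>2 \<le> (H * \<delta>)\<^sup>2"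
    by (metis abs_ge_zero power2_abs power_mono)
  have pointwise: "(ell_hat e f ?h k a n (\<lambda>i. Ys i \<omega>) (\<lambda>i. Zs i \<omega>) (\<lambda>i. Ws i \<omega>) - L)\<^sup>2 \<le> ?B \<omega>" for \<omega>
  proof -
    have "2 * (vec_norm2 ?h * a)\<^sup>2 * ?V \<omega> \<le> 2 * (H * a)\<^sup>2 * ?V \<omega>"
      using Ha by (intro mult_right_mono) auto
    then show ?thesis
      using ell_hat_error_le[OF T_mat_carrier T_nonsingular[OF k] a hc gcoeffs_carrier[OF k],
          of e f n "\<lambda>i. Ys i \<omega>" "\<lambda>i. Zs i \<omega>" "\<lambda>i. Ws i \<omega>" L \<phi>] bias
      by linarith
  qed
  have int: "integrable M ?B"
    using defect_square(1)[OF k] T_hat_frobenius(1)[OF n] by simp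
  have "(\<integral>\<^sup>+ \<omega>. ennreal ((ell_hat e f ?h k a n
            (\<lambda>i. Ys i \<omega>) (\<lambda>i. Zs i \<omega>) (\<lambda>i. Ws i \<omega>) - L)\<^sup>2) \<partial>M) \<le> (\<integral>\<^sup>+ \<omega>. ennreal (?B \<omega>) \<partial>M)"
    by (intro nn_integral_mono ennreal_leI pointwise)
  also have "\<dots> = ennreal (expectation ?B)"
    by (rule nn_integral_eq_integral[OF int])
      (rule AE_I2, rule order_trans[OF zero_le_power2 pointwise])
  also have "expectation ?B = 2 * (H * a)\<^sup>2 * expectation ?V + 2 * (H * \<delta>)\<^sup>2 + L\<^sup>2 * (a\<^sup>2 * expectation ?F)"
    using defect_square(1)[OF k] T_hat_frobenius(1)[OF n] by (simp add: prob_space)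
  also have "ennreal \<dots> \<le> ennreal (2 * (H * a)\<^sup>2 * (real k * (2 * (\<sigma>\<^sup>2 + \<eta>\<^sup>2 * \<delta>\<^sup>2)) / real n)
      + 2 * (H * \<delta>)\<^sup>2 + L\<^sup>2 * (a\<^sup>2 * ((real k)\<^sup>2 * \<eta>\<^sup>2 / real n)))"
    using defect_square(2)[OF k] T_hat_frobenius(2)[OF n]
    unfolding \<delta>_def by (intro ennreal_leI add_mono mult_left_mono) auto
  also have "2 * (H * a)\<^sup>2 * (real k * (2 * (\<sigma>\<^sup>2 + \<eta>\<^sup>2 * \<delta>\<^sup>2)) / real n)
      + 2 * (H * \<delta>)\<^sup>2 + L\<^sup>2 * (a\<^sup>2 * ((real k)\<^sup>2 * \<eta>\<^sup>2 / real n))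
    = 4 * H\<^sup>2 * (\<sigma>\<^sup>2 + \<eta>\<^sup>2 * \<delta>\<^sup>2) * (real k * a\<^sup>2 / real n) + 2 * (H * \<delta>)\<^sup>2
        + L\<^sup>2 * \<eta>\<^sup>2 * ((real k)\<^sup>2 * a\<^sup>2 / real n)"
    by (simp add: power_mult_distrib mult_ac)
  finally show ?thesis .
qed

end

section \<open>Consistency\<close>

theorem proposition3p1:
  fixes M :: "'a measure"
    and Y U :: "'a \<Rightarrow> real" and Z :: "'a \<Rightarrow> real ^ 'p" and W :: "'a \<Rightarrow> real ^ 'q"
    and Ys :: "nat \<Rightarrow> 'a \<Rightarrow> real" and Zs :: "nat \<Rightarrow> 'a \<Rightarrow> real ^ 'p" and Ws :: "nat \<Rightarrow> 'a \<Rightarrow> real ^ 'q"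
    and \<phi> h :: "real ^ 'p \<Rightarrow> real"
    and e :: "nat \<Rightarrow> real ^ 'p \<Rightarrow> real" and f :: "nat \<Rightarrow> real ^ 'q \<Rightarrow> real"
    and m :: "nat \<Rightarrow> nat" and \<alpha> :: "nat \<Rightarrow> real" and \<sigma> \<eta> :: real
  assumes "prob_space M"
    and "Y \<in> borel_measurable M" "Z \<in> borel_measurable M"
        "W \<in> borel_measurable M" "U \<in> borel_measurable M"
    and T_compact: "compact_op M Z W (cond_exp_op M Z W)"
    and T_injective: "injective_op M Z W (cond_exp_op M Z W)"
    and basis_Z: "orthonormal_basis M Z e"
    and basis_W: "orthonormal_basis M W f"
    and T_nonsingular: "\<forall>k\<ge>1. invertible_mat (T_mat M Z W e f k)"
    and sample_indep: "prob_space.indep_vars M (\<lambda>_. borel) (\<lambda>i \<omega>. (Ys i \<omega>, Zs i \<omega>, Ws i \<omega>)) UNIV"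
    and sample_distr: "\<forall>i. distr M borel (\<lambda>\<omega>. (Ys i \<omega>, Zs i \<omega>, Ws i \<omega>)) =
                           distr M borel (\<lambda>\<omega>. (Y \<omega>, Z \<omega>, W \<omega>))"
    and \<phi>_L2: "\<phi> \<in> L2 M Z" and h_L2: "h \<in> L2 M Z"
    and model: "AE \<omega> in M. Y \<omega> = \<phi> (Z \<omega>) + U \<omega>"
    and U_integrable: "integrable M U"
    and U_exogenous: "AE \<omega> in M. real_cond_exp M (sigma_gen M W) U \<omega> = 0"
    and \<sigma>_pos: "\<sigma> > 0"
    and U_var: "AE \<omega> in M. nn_cond_exp M (sigma_gen M W) (\<lambda>\<omega>. ennreal ((U \<omega>)\<^sup>2)) \<omega> \<le> ennreal (\<sigma>\<^sup>2)"
    and \<eta>_ge_1: "\<eta> \<ge> 1"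
    and f_bound: "\<forall>j. AE \<omega> in M.
          nn_cond_exp M (sigma_gen M Z) (\<lambda>\<omega>. ennreal ((f j (W \<omega>))\<^sup>2)) \<omega> \<le> ennreal (\<eta>\<^sup>2)"
    and ef_square_integrable: "\<forall>j l. integrable M (\<lambda>\<omega>. (e j (Z \<omega>) * f l (W \<omega>))\<^sup>2)"
    and ef_variance: "\<forall>j l. prob_space.variance M (\<lambda>\<omega>. e j (Z \<omega>) * f l (W \<omega>)) \<le> \<eta>\<^sup>2"
    and m_ge_1: "\<forall>n\<ge>1. m n \<ge> 1"
    and threshold: "\<forall>n\<ge>1. \<alpha> n \<ge> 2 * mat_opnorm (mat_inv (T_mat M Z W e f (m n)))"
    and m_rate: "(\<lambda>n. 1 / real (m n)) \<in> o(\<lambda>_. 1)"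
    and m_\<alpha>_rate: "(\<lambda>n. (real (m n))\<^sup>2 * (\<alpha> n)\<^sup>2) \<in> o(\<lambda>n. real n)"
    and stability: "(SUP k\<in>{1..}. l2_opnorm M Z (bias_op M Z W e f k)) < \<infinity>"
  shows "(\<lambda>n. \<integral>\<^sup>+ \<omega>. ennreal ((ell_hat e f (coeff_vec M Z e (m n) h) (m n) (\<alpha> n) n
                 (\<lambda>i. Ys i \<omega>) (\<lambda>i. Zs i \<omega>) (\<lambda>i. Ws i \<omega>) - l2_inner M Z h \<phi>)\<^sup>2) \<partial>M)
           \<longlonglongrightarrow> 0"
proof -
  interpret prob_space M by fact
  interpret npiv_model M Z W e f Y U Ys Zs Ws \<phi> \<sigma> \<eta>
    by unfold_locales (assumption | fact assms | rule T_nonsingular[rule_format]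
        sample_distr[rule_format] f_bound[rule_format] ef_square_integrable[rule_format]
        ef_variance[rule_format])+
  let ?H = "l2_norm M Z h" and ?L = "l2_inner M Z h \<phi>"
  define \<delta> where "\<delta> k = l2_norm M Z (\<lambda>x. \<phi> x - sol k \<phi> x)" for k
  obtain C where C: "0 \<le> C" "\<And>k. k \<ge> 1 \<Longrightarrow> l2_opnorm M Z (bias_op M Z W e f k) \<le> ennreal C"
  proof -
    obtain C where "0 \<le> C" "(SUP k\<in>{1..}. l2_opnorm M Z (bias_op M Z W e f k)) = ennreal C"
      using stability by (auto simp: less_top_ennreal)
    then show ?thesis
      by (intro that[of C]) (metis SUP_upper atLeast_iff)+
  qed
  have "eventually (\<lambda>n. m n \<ge> N) sequentially" for N
  proof -
    have "eventually (\<lambda>n. norm (1 / real (m n)) \<le> 1 / (real N + 1) * norm (1 :: real)) sequentially"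
      by (rule landau_o.smallD[OF m_rate]) simp
    with eventually_ge_at_top[of 1] show ?thesis
    proof eventually_elim
      case (elim n)
      then have "m n \<ge> 1"
        using m_ge_1 by simp
      with elim show ?case
        by (simp add: field_simps)
    qed
  qed
  then have m_top: "filterlim m at_top sequentially"
    by (simp add: filterlim_at_top)
  have "(\<lambda>k. (1 + C) * l2_norm M Z (residual k \<phi>)) \<longlonglongrightarrow> 0"
    by (rule tendsto_mult_right_zero[OF fourier_sum_residual_tendsto_0[OF Z e \<phi>_L2]])
  moreover have "eventually (\<lambda>k. norm (\<delta> k) \<le> (1 + C) * l2_norm M Z (residual k \<phi>)) sequentially"
    using eventually_ge_at_top[of 1]
    by eventually_elim
      (use galerkin_error_le[OF _ \<phi>_L2 C] in \<open>simp add: \<delta>_def l2_norm_nonneg\<close>)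
  ultimately have "\<delta> \<longlonglongrightarrow> 0"
    by (rule Lim_null_comparison[rotated])
  then have \<delta>: "(\<lambda>n. \<delta> (m n)) \<longlonglongrightarrow> 0"
    by (rule filterlim_compose[OF _ m_top])
  define r where "r n = (real (m n))\<^sup>2 * (\<alpha> n)\<^sup>2 / real n" for n
  have r: "r \<longlonglongrightarrow> 0"
    unfolding r_def by (rule smalloD_tendsto[OF m_\<alpha>_rate])
  have r': "(\<lambda>n. real (m n) * (\<alpha> n)\<^sup>2 / real n) \<longlonglongrightarrow> 0"
    \<comment> \<open>The defect contributes a single factor \<open>m\<close>, which \<open>m \<ge> 1\<close> bounds by \<open>m\<^sup>2\<close>.\<close>
  proof (rule Lim_null_comparison[OF _ r])
    show "eventually (\<lambda>n. norm (real (m n) * (\<alpha> n)\<^sup>2 / real n) \<le> r n) sequentially"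
      using eventually_ge_at_top[of 1]
    proof eventually_elim
      case (elim n)
      then have "m n \<ge> 1"
        using m_ge_1 by simp
      then have "real (m n) \<le> (real (m n))\<^sup>2"
        by (intro self_le_power) auto
      then show ?case
        by (simp add: r_def divide_right_mono mult_right_mono)
    qed
  qed
  let ?b = "\<lambda>n. 4 * ?H\<^sup>2 * (\<sigma>\<^sup>2 + \<eta>\<^sup>2 * (\<delta> (m n))\<^sup>2) * (real (m n) * (\<alpha> n)\<^sup>2 / real n)
    + 2 * (?H * \<delta> (m n))\<^sup>2 + ?L\<^sup>2 * \<eta>\<^sup>2 * r n"
  have "?b \<longlonglongrightarrow> 4 * ?H\<^sup>2 * (\<sigma>\<^sup>2 + \<eta>\<^sup>2 * 0\<^sup>2) * 0 + 2 * (?H * 0)\<^sup>2 + ?L\<^sup>2 * \<eta>\<^sup>2 * 0"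
    by (intro tendsto_intros \<delta> r r')
  from tendsto_ennrealI[OF this] have lim: "(\<lambda>n. ennreal (?b n)) \<longlonglongrightarrow> 0"
    by simp
  have upper: "eventually (\<lambda>n. (\<integral>\<^sup>+ \<omega>. ennreal ((ell_hat e f (coeff_vec M Z e (m n) h) (m n) (\<alpha> n) n
                 (\<lambda>i. Ys i \<omega>) (\<lambda>i. Zs i \<omega>) (\<lambda>i. Ws i \<omega>) - l2_inner M Z h \<phi>)\<^sup>2) \<partial>M) \<le> ennreal (?b n)) sequentially"
    using eventually_ge_at_top[of 1]
  proof eventually_elim
    case (elim n)
    then show ?case
      using risk_bound[OF _ elim h_L2, of "m n" "\<alpha> n"] m_ge_1 threshold
      by (simp add: \<delta>_def r_def)
  qed
  show ?thesis
    by (rule tendsto_sandwich[OF always_eventually upper tendsto_const lim]) simp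
qed

end
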